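(* Let $Q$ and $R$ be inverse quantal frames and $X$ a $Q$-$R$-bisheaf. The following conditions are equivalent: 1. $X$ is a biprincipal $Q$-$R$-bisheaf; 2. $X$ is a principal $Q$-$R$-bisheaf with inverse given by $X^*$ in the category $\mathit{InvQuF}_{\mathrm{HS}}$ (that is, $X^*$ is a principal $R$-$Q$-bisheaf and the morphisms $R\to Q$ and $Q\to R$ of $\mathit{InvQuF}_{\mathrm{HS}}$ represented by $X$ and $X^*$ are mutually inverse).
   Context: A unital involutive quantale $Q$ is a complete lattice with an associative multiplication preserving arbitrary joins in each variable, unit $e_Q$, and a join-preserving involution with $a^{**}=a$, $(ab)^*=b^*a^*$. Put $Q_0={\downarrow}e_Q$ and $Q_{\mathcal I}=\{s\in Q:ss^*\vee s^*s\le e_Q\}$. An inverse quantal frame is a unital involutive quantale which is a locale (binary meets distribute over joins), with $\bigvee Q_{\mathcal I}=1_Q$, and with a (unique) stable support: a join-preserving $\varsigma_Q:Q\to Q_0$ with $\varsigma_Q(a)\le aa^*$, $a\le\varsigma_Q(a)a$, $\varsigma_Q(ab)\le\varsigma_Q(a)$. Top elements are denoted $1$. A left $Q$-locale is a locale $X$ with a unital associative left action of $Q$ preserving joins in each variable, with $bx=b1_X\wedge x$ for $b\in Q_0$. It is a $Q$-sheaf if there is a (necessarily unique) monotone $Q_0$-equivariant $\varsigma_X:X\to Q_0$ with $\varsigma_X(x)x=x$ for all $x$, and $\bigvee\Gamma_X=1_X$, where $\Gamma_X$ (local sections) is the set of $s\in X$ with $\varsigma_X(x)s=x$ for all $x\le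 s$. A $Q$-sheaf has a canonical inner product $\langle-,-\rangle:X\times X\to Q$, the unique map preserving joins in each variable with, for $s,t\in\Gamma_X$, $\langle s,t\rangle=\bigvee\{v\in Q_{\mathcal I}:\varsigma_Q(v)\le\varsigma_X(s),\varsigma_Q(v^* )\le\varsigma_X(t),vt\le s\}$. A principal section is $s\in\Gamma_X$ with $\langle s,s\rangle\le e_Q$. Right $R$-sheaves are defined symmetrically (equivalently, via the left action $r\cdot x=xr^*$). A $Q$-$R$-bisheaf is a $Q$-$R$-bimodule $X$ (commuting unital left and right actions) that is a left $Q$-sheaf and a right $R$-sheaf. The dual $X^*$ is $X$ regarded as an $R$-$Q$-bisheaf by $r\cdot x=xr^*$, $x\cdot a=a^*x$. A $Q$-$R$-bisheaf $X$ is principal if the join of its principal sections (as a $Q$-sheaf) is $1_X$ and $c\mapsto1_Xc$ is an isomorphism from $R_0$ onto $I(X)=\{x\in X:1_Qx=x\}$. It is biprincipal if $X$ is a principal $Q$-$R$-bisheaf and $X^*$ is a principal $R$-$Q$-bisheaf. The category $\mathit{InvQuF}_{\mathrm{HS}}$ has inverse quantal frames as objects; morphisms $R\to Q$ are isomorphism classes of principal $Q$-$R$-bisheaves (maps of bisheaves being locale maps whose inverse images are bimodule homomorphisms); the composite of the classes of ${}_QX_R$ and ${}_RY_S$ is the class of the tensor product $X\otimes_RY$ (quotient of the sup-lattice tensor product $X\otimes Y$ by $xr\otimes y=x\otimes ry$); the identity on $Q$ is the class of $Q$ as a $Q$-$Q$-bisheaf. *)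

theory Defs
  imports "HOL-Algebra.Complete_Lattice" "HOL-Library.FuncSet"
begin

text \<open>
  All structures are carrier-based and extend the order structures of HOL-Algebra, whose
  complete lattices, joins, meets and top elements are used throughout; HOL-Algebra's
  \<^const>\<open>complete_lattice\<close> forces the \<^const>\<open>eq\<close> field to be equality.
\<close>

subsection \<open>Inverse quantal frames\<close>

record 'a iquantale = "'a gorder" +
  qmult :: "'a \<Rightarrow> 'a \<Rightarrow> 'a" (infixl \<open>\<cdot>\<index>\<close> 75)
  qunit :: 'a (\<open>\<e>\<index>\<close>)
  qstar :: "'a \<Rightarrow> 'a" (\<open>_\<^sup>\<star>\<index>\<close> [1000] 999)

locale frame = complete_lattice L for L (structure) +
  assumes meet_Sup:
    "\<lbrakk>x \<in> carrier L; A \<subseteq> carrier L\<rbrakk> \<Longrightarrow> x \<sqinter> (\<Squnion>A) = \<Squnion>((\<lambda>a. x \<sqinter> a) ` A)"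

locale unital_involutive_quantale = complete_lattice Q for Q (structure) +
  assumes mult_closed: "\<lbrakk>a \<in> carrier Q; b \<in> carrier Q\<rbrakk> \<Longrightarrow> a \<cdot> b \<in> carrier Q"
    and mult_assoc:
      "\<lbrakk>a \<in> carrier Q; b \<in> carrier Q; c \<in> carrier Q\<rbrakk> \<Longrightarrow> (a \<cdot> b) \<cdot> c = a \<cdot> (b \<cdot> c)"
    and mult_Sup_left: "b \<in> carrier Q \<Longrightarrow> sup_pres Q Q (\<lambda>a. a \<cdot> b)"
    and mult_Sup_right: "a \<in> carrier Q \<Longrightarrow> sup_pres Q Q (\<lambda>b. a \<cdot> b)"
    and unit_closed: "\<e> \<in> carrier Q"
    and unit_left: "a \<in> carrier Q \<Longrightarrow> \<e> \<cdot> a = a"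
    and unit_right: "a \<in> carrier Q \<Longrightarrow> a \<cdot> \<e> = a"
    and star_closed: "a \<in> carrier Q \<Longrightarrow> a\<^sup>\<star> \<in> carrier Q"
    and star_Sup: "sup_pres Q Q (\<lambda>a. a\<^sup>\<star>)"
    and star_star: "a \<in> carrier Q \<Longrightarrow> (a\<^sup>\<star>)\<^sup>\<star> = a"
    and star_mult: "\<lbrakk>a \<in> carrier Q; b \<in> carrier Q\<rbrakk> \<Longrightarrow> (a \<cdot> b)\<^sup>\<star> = b\<^sup>\<star> \<cdot> a\<^sup>\<star>"

definition base :: "('q, 'm) iquantale_scheme \<Rightarrow> 'q set" where
  "base Q = {a \<in> carrier Q. a \<sqsubseteq>\<^bsub>Q\<^esub> \<e>\<^bsub>Q\<^esub>}"

definition partial_units :: "('q, 'm) iquantale_scheme \<Rightarrow> 'q set" where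
  "partial_units Q =
     {s \<in> carrier Q. (s \<cdot>\<^bsub>Q\<^esub> s\<^sup>\<star>\<^bsub>Q\<^esub>) \<squnion>\<^bsub>Q\<^esub> (s\<^sup>\<star>\<^bsub>Q\<^esub> \<cdot>\<^bsub>Q\<^esub> s) \<sqsubseteq>\<^bsub>Q\<^esub> \<e>\<^bsub>Q\<^esub>}"

text \<open>
  Supports and inner products are unique only on the carrier.  They are therefore taken to be
  extensional functions, so that definite descriptions can be used.
\<close>

definition stable_support :: "('q, 'm) iquantale_scheme \<Rightarrow> ('q \<Rightarrow> 'q) \<Rightarrow> bool" where
  "stable_support Q \<sigma> \<longleftrightarrow>
     \<sigma> \<in> carrier Q \<rightarrow>\<^sub>E base Q \<and>
     sup_pres Q (Q\<lparr>carrier := base Q\<rparr>) \<sigma> \<and>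
     (\<forall>a\<in>carrier Q. \<sigma> a \<sqsubseteq>\<^bsub>Q\<^esub> a \<cdot>\<^bsub>Q\<^esub> a\<^sup>\<star>\<^bsub>Q\<^esub>) \<and>
     (\<forall>a\<in>carrier Q. a \<sqsubseteq>\<^bsub>Q\<^esub> \<sigma> a \<cdot>\<^bsub>Q\<^esub> a) \<and>
     (\<forall>a\<in>carrier Q. \<forall>b\<in>carrier Q. \<sigma> (a \<cdot>\<^bsub>Q\<^esub> b) \<sqsubseteq>\<^bsub>Q\<^esub> \<sigma> a)"

definition qsupp :: "('q, 'm) iquantale_scheme \<Rightarrow> 'q \<Rightarrow> 'q" where
  "qsupp Q = (THE \<sigma>. stable_support Q \<sigma>)"

locale inverse_quantal_frame = unital_involutive_quantale Q + frame Q for Q (structure) +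
  assumes Sup_partial_units: "\<Squnion>(partial_units Q) = \<top>"
    and stable_support_exists: "\<exists>\<sigma>. stable_support Q \<sigma>"

subsection \<open>Sheaves\<close>

text \<open>
  The action is a separate argument, so that the same notions apply to a left action and to the
  left action \<open>r \<cdot> x = x r\<^sup>\<star>\<close> obtained from a right action.
\<close>

definition left_module ::
    "('q, 'm) iquantale_scheme \<Rightarrow> ('x, 'n) gorder_scheme \<Rightarrow> ('q \<Rightarrow> 'x \<Rightarrow> 'x) \<Rightarrow> bool" where
  "left_module Q X act \<longleftrightarrow>
     complete_lattice X \<and>
     (\<forall>a\<in>carrier Q. \<forall>x\<in>carrier X. act a x \<in> carrier X) \<and>
     (\<forall>x\<in>carrier X. act \<e>\<^bsub>Q\<^esub> x = x) \<and>
     (\<forall>a\<in>carrier Q. \<forall>b\<in>carrier Q. \<forall>x\<in>carrier X. act (a \<cdot>\<^bsub>Q\<^esub> b) x = act a (act b x)) \<and>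
     (\<forall>x\<in>carrier X. sup_pres Q X (\<lambda>a. act a x)) \<and>
     (\<forall>a\<in>carrier Q. sup_pres X X (act a))"

definition right_module ::
    "('r, 'm) iquantale_scheme \<Rightarrow> ('x, 'n) gorder_scheme \<Rightarrow> ('x \<Rightarrow> 'r \<Rightarrow> 'x) \<Rightarrow> bool" where
  "right_module R X act \<longleftrightarrow>
     complete_lattice X \<and>
     (\<forall>x\<in>carrier X. \<forall>r\<in>carrier R. act x r \<in> carrier X) \<and>
     (\<forall>x\<in>carrier X. act x \<e>\<^bsub>R\<^esub> = x) \<and>
     (\<forall>x\<in>carrier X. \<forall>r\<in>carrier R. \<forall>s\<in>carrier R. act x (r \<cdot>\<^bsub>R\<^esub> s) = act (act x r) s) \<and>
     (\<forall>x\<in>carrier X. sup_pres R X (act x)) \<and>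
     (\<forall>r\<in>carrier R. sup_pres X X (\<lambda>x. act x r))"

definition left_locale ::
    "('q, 'm) iquantale_scheme \<Rightarrow> ('x, 'n) gorder_scheme \<Rightarrow> ('q \<Rightarrow> 'x \<Rightarrow> 'x) \<Rightarrow> bool" where
  "left_locale Q X act \<longleftrightarrow>
     frame X \<and> left_module Q X act \<and>
     (\<forall>b\<in>base Q. \<forall>x\<in>carrier X. act b x = act b \<top>\<^bsub>X\<^esub> \<sqinter>\<^bsub>X\<^esub> x)"

definition sheaf_support ::
    "('q, 'm) iquantale_scheme \<Rightarrow> ('x, 'n) gorder_scheme \<Rightarrow> ('q \<Rightarrow> 'x \<Rightarrow> 'x) \<Rightarrow> ('x \<Rightarrow> 'q) \<Rightarrow> bool"
  where
  "sheaf_support Q X act \<sigma> \<longleftrightarrow>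
     \<sigma> \<in> carrier X \<rightarrow>\<^sub>E base Q \<and>
     (\<forall>x\<in>carrier X. \<forall>y\<in>carrier X. x \<sqsubseteq>\<^bsub>X\<^esub> y \<longrightarrow> \<sigma> x \<sqsubseteq>\<^bsub>Q\<^esub> \<sigma> y) \<and>
     (\<forall>b\<in>base Q. \<forall>x\<in>carrier X. \<sigma> (act b x) = b \<cdot>\<^bsub>Q\<^esub> \<sigma> x) \<and>
     (\<forall>x\<in>carrier X. act (\<sigma> x) x = x)"

definition supp ::
    "('q, 'm) iquantale_scheme \<Rightarrow> ('x, 'n) gorder_scheme \<Rightarrow> ('q \<Rightarrow> 'x \<Rightarrow> 'x) \<Rightarrow> 'x \<Rightarrow> 'q" where
  "supp Q X act = (THE \<sigma>. sheaf_support Q X act \<sigma>)"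

definition local_sections ::
    "('q, 'm) iquantale_scheme \<Rightarrow> ('x, 'n) gorder_scheme \<Rightarrow> ('q \<Rightarrow> 'x \<Rightarrow> 'x) \<Rightarrow> 'x set" where
  "local_sections Q X act =
     {s \<in> carrier X. \<forall>x\<in>carrier X. x \<sqsubseteq>\<^bsub>X\<^esub> s \<longrightarrow> act (supp Q X act x) s = x}"

definition left_sheaf ::
    "('q, 'm) iquantale_scheme \<Rightarrow> ('x, 'n) gorder_scheme \<Rightarrow> ('q \<Rightarrow> 'x \<Rightarrow> 'x) \<Rightarrow> bool" where
  "left_sheaf Q X act \<longleftrightarrow>
     left_locale Q X act \<and>
     (\<exists>\<sigma>. sheaf_support Q X act \<sigma>) \<and>
     \<Squnion>\<^bsub>X\<^esub>(local_sections Q X act) = \<top>\<^bsub>X\<^esub>"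

definition right_sheaf ::
    "('r, 'm) iquantale_scheme \<Rightarrow> ('x, 'n) gorder_scheme \<Rightarrow> ('x \<Rightarrow> 'r \<Rightarrow> 'x) \<Rightarrow> bool" where
  "right_sheaf R X act \<longleftrightarrow>
     right_module R X act \<and> left_sheaf R X (\<lambda>r x. act x (r\<^sup>\<star>\<^bsub>R\<^esub>))"

definition is_inner_product ::
    "('q, 'm) iquantale_scheme \<Rightarrow> ('x, 'n) gorder_scheme \<Rightarrow> ('q \<Rightarrow> 'x \<Rightarrow> 'x) \<Rightarrow>
     ('x \<times> 'x \<Rightarrow> 'q) \<Rightarrow> bool" where
  "is_inner_product Q X act ip \<longleftrightarrow>
     ip \<in> carrier X \<times> carrier X \<rightarrow>\<^sub>E carrier Q \<and>
     (\<forall>y\<in>carrier X. sup_pres X Q (\<lambda>x. ip (x, y))) \<and>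
     (\<forall>x\<in>carrier X. sup_pres X Q (\<lambda>y. ip (x, y))) \<and>
     (\<forall>s\<in>local_sections Q X act. \<forall>t\<in>local_sections Q X act.
        ip (s, t) = \<Squnion>\<^bsub>Q\<^esub>{v \<in> partial_units Q.
                         qsupp Q v \<sqsubseteq>\<^bsub>Q\<^esub> supp Q X act s \<and>
                         qsupp Q (v\<^sup>\<star>\<^bsub>Q\<^esub>) \<sqsubseteq>\<^bsub>Q\<^esub> supp Q X act t \<and>
                         act v t \<sqsubseteq>\<^bsub>X\<^esub> s})"

definition inner_product ::
    "('q, 'm) iquantale_scheme \<Rightarrow> ('x, 'n) gorder_scheme \<Rightarrow> ('q \<Rightarrow> 'x \<Rightarrow> 'x) \<Rightarrow> 'x \<times> 'x \<Rightarrow> 'q"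
  where
  "inner_product Q X act = (THE ip. is_inner_product Q X act ip)"

definition principal_sections ::
    "('q, 'm) iquantale_scheme \<Rightarrow> ('x, 'n) gorder_scheme \<Rightarrow> ('q \<Rightarrow> 'x \<Rightarrow> 'x) \<Rightarrow> 'x set" where
  "principal_sections Q X act =
     {s \<in> local_sections Q X act. inner_product Q X act (s, s) \<sqsubseteq>\<^bsub>Q\<^esub> \<e>\<^bsub>Q\<^esub>}"

subsection \<open>Bisheaves\<close>

record ('q, 'r, 'x) bimod = "'x gorder" +
  lact :: "'q \<Rightarrow> 'x \<Rightarrow> 'x"
  ract :: "'x \<Rightarrow> 'r \<Rightarrow> 'x"

definition bimodule :: "'q iquantale \<Rightarrow> 'r iquantale \<Rightarrow> ('q, 'r, 'x) bimod \<Rightarrow> bool" where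
  "bimodule Q R X \<longleftrightarrow>
     left_module Q X (lact X) \<and> right_module R X (ract X) \<and>
     (\<forall>a\<in>carrier Q. \<forall>x\<in>carrier X. \<forall>r\<in>carrier R.
        ract X (lact X a x) r = lact X a (ract X x r))"

definition bisheaf :: "'q iquantale \<Rightarrow> 'r iquantale \<Rightarrow> ('q, 'r, 'x) bimod \<Rightarrow> bool" where
  "bisheaf Q R X \<longleftrightarrow>
     bimodule Q R X \<and> left_sheaf Q X (lact X) \<and> right_sheaf R X (ract X)"

definition dual_bimod ::
    "'q iquantale \<Rightarrow> 'r iquantale \<Rightarrow> ('q, 'r, 'x) bimod \<Rightarrow> ('r, 'q, 'x) bimod" where
  "dual_bimod Q R X =
     \<lparr>carrier = carrier X, eq = eq X, le = le X,
      lact = (\<lambda>r x. ract X x (r\<^sup>\<star>\<^bsub>R\<^esub>)), ract = (\<lambda>x a. lact X (a\<^sup>\<star>\<^bsub>Q\<^esub>) x)\<rparr>"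

definition invariants :: "'q iquantale \<Rightarrow> ('q, 'r, 'x) bimod \<Rightarrow> 'x set" where
  "invariants Q X = {x \<in> carrier X. lact X \<top>\<^bsub>Q\<^esub> x = x}"

definition order_iso_on ::
    "('a, 'm) gorder_scheme \<Rightarrow> 'a set \<Rightarrow> ('b, 'n) gorder_scheme \<Rightarrow> 'b set \<Rightarrow> ('a \<Rightarrow> 'b) \<Rightarrow> bool" where
  "order_iso_on L A M B f \<longleftrightarrow>
     bij_betw f A B \<and> (\<forall>x\<in>A. \<forall>y\<in>A. f x \<sqsubseteq>\<^bsub>M\<^esub> f y \<longleftrightarrow> x \<sqsubseteq>\<^bsub>L\<^esub> y)"

definition principal_bisheaf :: "'q iquantale \<Rightarrow> 'r iquantale \<Rightarrow> ('q, 'r, 'x) bimod \<Rightarrow> bool" where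
  "principal_bisheaf Q R X \<longleftrightarrow>
     bisheaf Q R X \<and>
     \<Squnion>\<^bsub>X\<^esub>(principal_sections Q X (lact X)) = \<top>\<^bsub>X\<^esub> \<and>
     order_iso_on R (base R) X (invariants Q X) (\<lambda>c. ract X \<top>\<^bsub>X\<^esub> c)"

definition biprincipal_bisheaf :: "'q iquantale \<Rightarrow> 'r iquantale \<Rightarrow> ('q, 'r, 'x) bimod \<Rightarrow> bool" where
  "biprincipal_bisheaf Q R X \<longleftrightarrow>
     principal_bisheaf Q R X \<and> principal_bisheaf R Q (dual_bimod Q R X)"

subsection \<open>Morphisms of inverse quantal frames\<close>

text \<open>
  A map of bisheaves from \<open>X\<close> to \<open>Y\<close> is a locale map, given here by its inverse image
  \<open>f :: 'y \<Rightarrow> 'x\<close>, a frame homomorphism from \<open>Y\<close> to \<open>X\<close>.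
\<close>

definition bisheaf_map ::
    "'q iquantale \<Rightarrow> 'r iquantale \<Rightarrow> ('q, 'r, 'x) bimod \<Rightarrow> ('q, 'r, 'y) bimod \<Rightarrow> ('y \<Rightarrow> 'x) \<Rightarrow> bool"
  where
  "bisheaf_map Q R X Y f \<longleftrightarrow>
     frame X \<and> frame Y \<and>
     f \<in> carrier Y \<rightarrow> carrier X \<and>
     sup_pres Y X f \<and>
     f \<top>\<^bsub>Y\<^esub> = \<top>\<^bsub>X\<^esub> \<and>
     (\<forall>y\<in>carrier Y. \<forall>z\<in>carrier Y. f (y \<sqinter>\<^bsub>Y\<^esub> z) = f y \<sqinter>\<^bsub>X\<^esub> f z) \<and>
     (\<forall>a\<in>carrier Q. \<forall>y\<in>carrier Y. f (lact Y a y) = lact X a (f y)) \<and>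
     (\<forall>y\<in>carrier Y. \<forall>r\<in>carrier R. f (ract Y y r) = ract X (f y) r)"

text \<open>
  The morphisms of the Hilsum-Skandalis category are isomorphism classes, so equality of the
  morphisms represented by \<open>X\<close> and \<open>Y\<close> is the existence of an isomorphism of bisheaves.
\<close>

definition same_HS_morphism ::
    "'q iquantale \<Rightarrow> 'r iquantale \<Rightarrow> ('q, 'r, 'x) bimod \<Rightarrow> ('q, 'r, 'y) bimod \<Rightarrow> bool" where
  "same_HS_morphism Q R X Y \<longleftrightarrow>
     (\<exists>f g. bisheaf_map Q R X Y f \<and> bisheaf_map Q R Y X g \<and>
        (\<forall>y\<in>carrier Y. g (f y) = y) \<and> (\<forall>x\<in>carrier X. f (g x) = x))"

definition unit_bimod :: "'q iquantale \<Rightarrow> ('q, 'q, 'q) bimod" where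
  "unit_bimod Q =
     \<lparr>carrier = carrier Q, eq = eq Q, le = le Q, lact = qmult Q, ract = qmult Q\<rparr>"

text \<open>
  A quotient of a sup-lattice is represented by the elements closed for the corresponding closure
  operator.  The sup-lattice \<open>X \<otimes>\<^sub>R Y\<close> is the quotient of the free sup-lattice on
  \<open>X \<times> Y\<close>, i.e. the powerset under inclusion, by the relations
  \<open>\<Squnion>A \<otimes> y = \<Squnion>(a \<otimes> y)\<close>, \<open>x \<otimes> \<Squnion>B = \<Squnion>(x \<otimes> b)\<close> and \<open>xr \<otimes> y = x \<otimes> ry\<close>; the sets closed
  for a relation \<open>u = v\<close> are those which contain \<open>u\<close> if and only if they contain \<open>v\<close>.
\<close>

definition tensor_sets ::
    "'r iquantale \<Rightarrow> ('q, 'r, 'x) bimod \<Rightarrow> ('r, 's, 'y) bimod \<Rightarrow> ('x \<times> 'y) set set" where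
  "tensor_sets R X Y =
     {D. D \<subseteq> carrier X \<times> carrier Y \<and>
         (\<forall>A y. A \<subseteq> carrier X \<longrightarrow> y \<in> carrier Y \<longrightarrow>
            ((\<Squnion>\<^bsub>X\<^esub>A, y) \<in> D \<longleftrightarrow> A \<times> {y} \<subseteq> D)) \<and>
         (\<forall>x B. x \<in> carrier X \<longrightarrow> B \<subseteq> carrier Y \<longrightarrow>
            ((x, \<Squnion>\<^bsub>Y\<^esub>B) \<in> D \<longleftrightarrow> {x} \<times> B \<subseteq> D)) \<and>
         (\<forall>x r y. x \<in> carrier X \<longrightarrow> r \<in> carrier R \<longrightarrow> y \<in> carrier Y \<longrightarrow>
            ((ract X x r, y) \<in> D \<longleftrightarrow> (x, lact Y r y) \<in> D))}"

definition tensor_closure ::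
    "'r iquantale \<Rightarrow> ('q, 'r, 'x) bimod \<Rightarrow> ('r, 's, 'y) bimod \<Rightarrow> ('x \<times> 'y) set \<Rightarrow> ('x \<times> 'y) set"
  where
  "tensor_closure R X Y U = \<Inter>{D \<in> tensor_sets R X Y. U \<subseteq> D}"

text \<open>
  The pure tensor \<open>x \<otimes> y\<close> is the closure of \<open>{(x, y)}\<close>, and a closed set is the join of the pure
  tensors of its elements.  The actions are the ones with \<open>a(x \<otimes> y) = (ax) \<otimes> y\<close> and
  \<open>(x \<otimes> y)s = x \<otimes> (ys)\<close>.
\<close>

definition tensor ::
    "'r iquantale \<Rightarrow> ('q, 'r, 'x) bimod \<Rightarrow> ('r, 's, 'y) bimod \<Rightarrow> ('q, 's, ('x \<times> 'y) set) bimod" where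
  "tensor R X Y =
     \<lparr>carrier = tensor_sets R X Y, eq = (=), le = (\<subseteq>),
      lact = (\<lambda>a D. tensor_closure R X Y ((\<lambda>(x, y). (lact X a x, y)) ` D)),
      ract = (\<lambda>D s. tensor_closure R X Y ((\<lambda>(x, y). (x, ract Y y s)) ` D))\<rparr>"

end

theory Submission
  imports Defs
begin

text \<open>
  Only one implication has content: if \<open>X\<close> and \<open>X\<^sup>*\<close> are principal, then \<open>X \<otimes> X\<^sup>*\<close> over \<open>R\<close> is
  isomorphic to \<open>Q\<close>; the isomorphism of \<open>X\<^sup>* \<otimes> X\<close> over \<open>Q\<close> with \<open>R\<close> follows by duality.  Write
  \<open>\<langle>x, y\<rangle>\<close> for the inner product over \<open>Q\<close> and \<open>[x, y]\<close> for the inner product over \<open>R\<close>.  The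
  isomorphism is \<open>x \<otimes> y \<mapsto> \<langle>x, y\<rangle>\<close>, with inverse \<open>a \<mapsto> \<Squnion> (a s) \<otimes> s\<close>, where \<open>s\<close> ranges over the
  principal sections.

  The map is well defined, and linear on both sides, because the inner product preserves joins,
  satisfies \<open>\<langle>a x, y\<rangle> = a \<langle>x, y\<rangle>\<close> and \<open>\<langle>x, y\<rangle>\<^sup>\<star> = \<langle>y, x\<rangle>\<close>, and is balanced, \<open>\<langle>x r, y\<rangle> = \<langle>x, y r\<^sup>\<star>\<rangle>\<close>
  (\<open>ip_act_other\<close>).  All of this is read off from an explicit description of \<open>\<langle>x, y\<rangle>\<close> for
  arbitrary \<open>x\<close> and \<open>y\<close> as a join of partial units (\<open>inner_product_eq\<close>).

  That it is bijective rests on two facts.  The principal sections resolve the unit: the join of the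
  \<open>\<langle>s, s\<rangle>\<close> is the unit of \<open>Q\<close> (\<open>Sup_ip_psections\<close>), since each \<open>\<langle>s, s\<rangle>\<close> lies between the support of
  \<open>s\<close> and the unit, and the support of the top element is the unit by principality of \<open>X\<^sup>*\<close>.  And
  the two inner products satisfy \<open>\<langle>x, y\<rangle> z = x [y, z]\<close> (\<open>imprimitivity\<close>), because the elements
  invariant under one action are exactly those that come from the base of the other quantale.
  Hence
    \<open>x \<otimes> y = \<Squnion> x \<otimes> \<langle>s, s\<rangle> y = \<Squnion> x \<otimes> s [s, y] = \<Squnion> x [y, s] \<otimes> s = \<Squnion> \<langle>x, y\<rangle> s \<otimes> s\<close>,
  while surjectivity is \<open>a = \<Squnion> a \<langle>s, s\<rangle> = \<Squnion> \<langle>a s, s\<rangle>\<close>.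
\<close>

section \<open>Complete lattices and order isomorphisms\<close>

lemma (in partial_order) least_eqI:
  assumes "least L x (Upper L A)" "A \<subseteq> carrier L"
  shows "\<Squnion>A = x"
  unfolding sup_def by (rule some_equality) (use assms least_unique in auto)

lemma (in partial_order) greatest_eqI:
  assumes "greatest L x (Lower L A)" "A \<subseteq> carrier L"
  shows "\<Sqinter>A = x"
  unfolding inf_def by (rule some_equality) (use assms greatest_unique in auto)

lemma (in complete_lattice) sup_le_iff:
  assumes "A \<subseteq> carrier L" "z \<in> carrier L"
  shows "\<Squnion>A \<sqsubseteq> z \<longleftrightarrow> (\<forall>a\<in>A. a \<sqsubseteq> z)"
  by (meson assms local.le_trans subsetD sup_closed sup_least sup_upper)

lemma (in complete_lattice) le_sup_I:
  assumes "A \<subseteq> carrier L" "a \<in> A" "z \<in> carrier L" "z \<sqsubseteq> a"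
  shows "z \<sqsubseteq> \<Squnion>A"
  by (meson assms local.le_trans subsetD sup_closed sup_upper)

lemma (in complete_lattice) sup_pair:
  assumes "x \<in> carrier L" "y \<in> carrier L" "x \<sqsubseteq> y"
  shows "\<Squnion>{x, y} = y"
  by (rule le_antisym) (use assms in \<open>auto simp: sup_le_iff intro: sup_upper\<close>)

lemma (in complete_lattice) top_eqI:
  assumes "t \<in> carrier L" "\<And>x. x \<in> carrier L \<Longrightarrow> x \<sqsubseteq> t"
  shows "\<top> = t"
  using assms by (metis le_antisym top_closed top_higher)

lemma sup_presD:
  "\<lbrakk>sup_pres L M f; A \<subseteq> carrier L\<rbrakk> \<Longrightarrow> f (\<Squnion>\<^bsub>L\<^esub>A) = \<Squnion>\<^bsub>M\<^esub>(f ` A)"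
  by (simp add: sup_pres_def)

lemma sup_pres_mono:
  assumes f: "sup_pres L M f" and fc: "f x \<in> carrier M" "f y \<in> carrier M"
    and xy: "x \<in> carrier L" "y \<in> carrier L" "x \<sqsubseteq>\<^bsub>L\<^esub> y"
  shows "f x \<sqsubseteq>\<^bsub>M\<^esub> f y"
proof -
  interpret L: complete_lattice L using f by (simp add: sup_pres_def)
  interpret M: complete_lattice M using f by (simp add: sup_pres_def)
  have "f y = \<Squnion>\<^bsub>M\<^esub>(f ` {x, y})"
    using sup_presD[OF f, of "{x, y}"] L.sup_pair xy by simp
  then show ?thesis
    using M.sup_upper[of "f ` {x, y}" "f x"] fc by simp
qed

lemma (in complete_lattice) meet_eq_left:
  assumes "x \<in> carrier L" "y \<in> carrier L" "x \<sqsubseteq> y"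
  shows "x \<sqinter> y = x"
  by (rule le_antisym) (use assms in \<open>auto intro: meet_left meet_le\<close>)

lemma (in frame) Sup_meet_cover:
  assumes "x \<in> carrier L" "\<Squnion>A = \<top>" "A \<subseteq> carrier L"
  shows "\<Squnion>((\<lambda>a. x \<sqinter> a) ` A) = x"
  using meet_Sup[of x A] assms by (simp add: meet_eq_left)

text \<open>
  Besides the comparison of the tensor product with the unit bimodule, this covers changes of the
  ambient record that keep the order, via the identity map.
\<close>

lemma frame_order_iso:
  assumes L: "frame L" and eqM: "eq M = (=)"
    and f: "\<And>x. x \<in> carrier L \<Longrightarrow> f x \<in> carrier M"
    and g: "\<And>y. y \<in> carrier M \<Longrightarrow> g y \<in> carrier L"
    and gf: "\<And>x. x \<in> carrier L \<Longrightarrow> g (f x) = x"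
    and fg: "\<And>y. y \<in> carrier M \<Longrightarrow> f (g y) = y"
    and le: "\<And>x y. \<lbrakk>x \<in> carrier L; y \<in> carrier L\<rbrakk> \<Longrightarrow> f x \<sqsubseteq>\<^bsub>M\<^esub> f y \<longleftrightarrow> x \<sqsubseteq>\<^bsub>L\<^esub> y"
  shows "frame M" and "sup_pres L M f" and "f \<top>\<^bsub>L\<^esub> = \<top>\<^bsub>M\<^esub>"
    and "\<And>x y. \<lbrakk>x \<in> carrier L; y \<in> carrier L\<rbrakk> \<Longrightarrow> f (x \<sqinter>\<^bsub>L\<^esub> y) = f x \<sqinter>\<^bsub>M\<^esub> f y"
proof -
  interpret L: frame L by (rule L)
  have le': "x \<sqsubseteq>\<^bsub>M\<^esub> y \<longleftrightarrow> g x \<sqsubseteq>\<^bsub>L\<^esub> g y" if "x \<in> carrier M" "y \<in> carrier M" for x y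
    using le[of "g x" "g y"] that by (simp add: g fg)
  have ginj: "x = y" if "x \<in> carrier M" "y \<in> carrier M" "g x = g y" for x y
    using that fg by metis
  interpret M: partial_order M
  proof
    show "x \<sqsubseteq>\<^bsub>M\<^esub> z" if "x \<sqsubseteq>\<^bsub>M\<^esub> y" "y \<sqsubseteq>\<^bsub>M\<^esub> z" "x \<in> carrier M" "y \<in> carrier M" "z \<in> carrier M"
      for x y z using that L.le_trans[of "g x" "g y" "g z"] by (simp add: le' g)
    show "x .=\<^bsub>M\<^esub> y" if "x \<sqsubseteq>\<^bsub>M\<^esub> y" "y \<sqsubseteq>\<^bsub>M\<^esub> x" "x \<in> carrier M" "y \<in> carrier M" for x y
      using that L.le_antisym[of "g x" "g y"] ginj[of x y] by (simp add: le' g eqM)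
  qed (auto simp: eqM le' g)
  have lub: "least M (f (\<Squnion>\<^bsub>L\<^esub>(g ` A))) (Upper M A)" if A: "A \<subseteq> carrier M" for A
  proof (rule least_UpperI)
    have gA: "g ` A \<subseteq> carrier L" using A g by auto
    show "x \<sqsubseteq>\<^bsub>M\<^esub> f (\<Squnion>\<^bsub>L\<^esub>(g ` A))" if "x \<in> A" for x
      using that A gA L.sup_upper[OF gA, of "g x"] by (subst le') (auto simp: f gf)
    show "f (\<Squnion>\<^bsub>L\<^esub>(g ` A)) \<sqsubseteq>\<^bsub>M\<^esub> y" if "y \<in> Upper M A" for y
    proof -
      have y: "y \<in> carrier M" "\<And>x. x \<in> A \<Longrightarrow> x \<sqsubseteq>\<^bsub>M\<^esub> y" using that A by (auto simp: Upper_def)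
      have "\<Squnion>\<^bsub>L\<^esub>(g ` A) \<sqsubseteq>\<^bsub>L\<^esub> g y"
        using gA g y A by (auto simp: L.sup_le_iff le'[symmetric] subset_iff)
      then show ?thesis using y gA by (simp add: le' f g gf)
    qed
    show "A \<subseteq> carrier M" "f (\<Squnion>\<^bsub>L\<^esub>(g ` A)) \<in> carrier M" using A gA f by auto
  qed
  have glb: "greatest M (f (\<Sqinter>\<^bsub>L\<^esub>(g ` A))) (Lower M A)" if A: "A \<subseteq> carrier M" for A
  proof (rule greatest_LowerI)
    have gA: "g ` A \<subseteq> carrier L" using A g by auto
    show "f (\<Sqinter>\<^bsub>L\<^esub>(g ` A)) \<sqsubseteq>\<^bsub>M\<^esub> x" if "x \<in> A" for x
      using that A gA L.inf_lower[OF gA, of "g x"] by (subst le') (auto simp: f gf)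
    show "y \<sqsubseteq>\<^bsub>M\<^esub> f (\<Sqinter>\<^bsub>L\<^esub>(g ` A))" if "y \<in> Lower M A" for y
    proof -
      have y: "y \<in> carrier M" "\<And>x. x \<in> A \<Longrightarrow> y \<sqsubseteq>\<^bsub>M\<^esub> x" using that A by (auto simp: Lower_def)
      have "g y \<sqsubseteq>\<^bsub>L\<^esub> \<Sqinter>\<^bsub>L\<^esub>(g ` A)"
        using gA g y A by (auto intro!: L.inf_greatest simp: le'[symmetric] subset_iff)
      then show ?thesis using y gA by (simp add: le' f g gf)
    qed
    show "A \<subseteq> carrier M" "f (\<Sqinter>\<^bsub>L\<^esub>(g ` A)) \<in> carrier M" using A gA f by auto
  qed
  interpret M: complete_lattice M
    by standard (use lub glb in blast)+
  have gfA: "g ` f ` A = A" if "A \<subseteq> carrier L" for A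
    using that gf by (force simp: image_iff subset_iff)
  have fA: "f ` A \<subseteq> carrier M" if "A \<subseteq> carrier L" for A using that f by auto
  have supM: "\<Squnion>\<^bsub>M\<^esub>A = f (\<Squnion>\<^bsub>L\<^esub>(g ` A))" if "A \<subseteq> carrier M" for A
    using M.least_eqI[OF lub] that by blast
  have infM: "\<Sqinter>\<^bsub>M\<^esub>A = f (\<Sqinter>\<^bsub>L\<^esub>(g ` A))" if "A \<subseteq> carrier M" for A
    using M.greatest_eqI[OF glb] that by blast
  show spf: "sup_pres L M f"
    unfolding sup_pres_def using supM fA gfA
    by (auto simp: L.complete_lattice_axioms M.complete_lattice_axioms)
  show "f \<top>\<^bsub>L\<^esub> = \<top>\<^bsub>M\<^esub>"
    by (rule M.top_eqI[symmetric]) (auto simp: f le' g gf)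
  show meet: "f (x \<sqinter>\<^bsub>L\<^esub> y) = f x \<sqinter>\<^bsub>M\<^esub> f y" if "x \<in> carrier L" "y \<in> carrier L" for x y
    using infM[of "{f x, f y}"] that by (simp add: meet_def f gf)
  show "frame M"
  proof
    fix x A assume x: "x \<in> carrier M" and A: "A \<subseteq> carrier M"
    have gA: "g ` A \<subseteq> carrier L" using A g by auto
    have img: "(\<lambda>a. x \<sqinter>\<^bsub>M\<^esub> a) ` A = f ` (\<lambda>b. g x \<sqinter>\<^bsub>L\<^esub> b) ` g ` A"
      unfolding image_image using x A by (intro image_cong) (auto simp: meet g fg)
    have "x \<sqinter>\<^bsub>M\<^esub> \<Squnion>\<^bsub>M\<^esub>A = f (g x) \<sqinter>\<^bsub>M\<^esub> f (\<Squnion>\<^bsub>L\<^esub>(g ` A))"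
      using x A by (simp add: supM fg)
    also have "\<dots> = f (g x \<sqinter>\<^bsub>L\<^esub> \<Squnion>\<^bsub>L\<^esub>(g ` A))"
      using x gA by (simp add: meet g)
    also have "\<dots> = f (\<Squnion>\<^bsub>L\<^esub>((\<lambda>b. g x \<sqinter>\<^bsub>L\<^esub> b) ` g ` A))"
      using x gA by (simp add: L.meet_Sup g)
    also have "\<dots> = \<Squnion>\<^bsub>M\<^esub>(f ` (\<lambda>b. g x \<sqinter>\<^bsub>L\<^esub> b) ` g ` A)"
      by (rule sup_presD[OF spf]) (use x gA g in auto)
    finally show "x \<sqinter>\<^bsub>M\<^esub> \<Squnion>\<^bsub>M\<^esub>A = \<Squnion>\<^bsub>M\<^esub>((\<lambda>a. x \<sqinter>\<^bsub>M\<^esub> a) ` A)"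
      using img by simp
  qed
qed

section \<open>Partial units of an inverse quantal frame\<close>

context unital_involutive_quantale
begin

declare mult_closed [simp] unit_closed [simp] unit_left [simp] unit_right [simp]
  star_closed [simp] star_star [simp]

lemma mult_mono:
  assumes "a \<sqsubseteq> a'" "b \<sqsubseteq> b'" "a \<in> carrier Q" "a' \<in> carrier Q" "b \<in> carrier Q" "b' \<in> carrier Q"
  shows "a \<cdot> b \<sqsubseteq> a' \<cdot> b'"
proof -
  have "a \<cdot> b \<sqsubseteq> a' \<cdot> b" using assms by (intro sup_pres_mono[OF mult_Sup_left[of b]]) auto
  also have "a' \<cdot> b \<sqsubseteq> a' \<cdot> b'" using assms by (intro sup_pres_mono[OF mult_Sup_right[of a']]) auto
  finally show ?thesis using assms by simp
qed

lemma star_mono: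
  "\<lbrakk>a \<sqsubseteq> b; a \<in> carrier Q; b \<in> carrier Q\<rbrakk> \<Longrightarrow> a\<^sup>\<star> \<sqsubseteq> b\<^sup>\<star>"
  by (intro sup_pres_mono[OF star_Sup]) auto

lemma star_le_iff: "\<lbrakk>a \<in> carrier Q; b \<in> carrier Q\<rbrakk> \<Longrightarrow> a\<^sup>\<star> \<sqsubseteq> b \<longleftrightarrow> a \<sqsubseteq> b\<^sup>\<star>"
  by (metis star_closed star_mono star_star)

lemma star_unit [simp]: "\<e>\<^sup>\<star> = \<e>"
  by (metis star_closed star_mult star_star unit_closed unit_left unit_right)

lemma baseI: "\<lbrakk>b \<in> carrier Q; b \<sqsubseteq> \<e>\<rbrakk> \<Longrightarrow> b \<in> base Q"
  by (simp add: base_def)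

lemma base_le_unit: "b \<in> base Q \<Longrightarrow> b \<sqsubseteq> \<e>"
  by (simp add: base_def)

lemma base_closed [simp]: "b \<in> base Q \<Longrightarrow> b \<in> carrier Q"
  unfolding base_def by blast

lemma unit_base [simp]: "\<e> \<in> base Q"
  by (simp add: baseI)

lemma base_mult_le:
  assumes "b \<in> base Q" "a \<in> carrier Q"
  shows "b \<cdot> a \<sqsubseteq> a" and "a \<cdot> b \<sqsubseteq> a"
  using mult_mono[of b \<e> a a] mult_mono[of a a b \<e>] assms by (auto simp: base_le_unit)

lemma base_mult [simp]:
  assumes "b \<in> base Q" "c \<in> base Q" shows "b \<cdot> c \<in> base Q"
  using mult_mono[of b \<e> c \<e>] assms by (intro baseI) (auto simp: base_le_unit)

lemma base_down: "\<lbrakk>b \<in> base Q; a \<in> carrier Q; a \<sqsubseteq> b\<rbrakk> \<Longrightarrow> a \<in> base Q"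
  using le_trans[of a b \<e>] by (auto intro!: baseI simp: base_le_unit)

lemma base_Sup [simp]: "A \<subseteq> base Q \<Longrightarrow> \<Squnion>A \<in> base Q"
  by (rule baseI) (auto simp: subset_iff sup_le_iff base_le_unit)

lemma partial_unit_iff:
  "s \<in> partial_units Q \<longleftrightarrow> s \<in> carrier Q \<and> s \<cdot> s\<^sup>\<star> \<in> base Q \<and> s\<^sup>\<star> \<cdot> s \<in> base Q"
  using join_le[of "s \<cdot> s\<^sup>\<star>" \<e> "s\<^sup>\<star> \<cdot> s"] join_left[of "s \<cdot> s\<^sup>\<star>" "s\<^sup>\<star> \<cdot> s"]
    join_right[of "s \<cdot> s\<^sup>\<star>" "s\<^sup>\<star> \<cdot> s"]
    le_trans[of "s \<cdot> s\<^sup>\<star>" "s \<cdot> s\<^sup>\<star> \<squnion> s\<^sup>\<star> \<cdot> s" \<e>] le_trans[of "s\<^sup>\<star> \<cdot> s" "s \<cdot> s\<^sup>\<star> \<squnion> s\<^sup>\<star> \<cdot> s" \<e>]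
  by (auto simp: partial_units_def base_def simp del: base_closed)

lemma partial_unitI:
  "\<lbrakk>s \<in> carrier Q; s \<cdot> s\<^sup>\<star> \<in> base Q; s\<^sup>\<star> \<cdot> s \<in> base Q\<rbrakk> \<Longrightarrow> s \<in> partial_units Q"
  by (simp add: partial_unit_iff)

lemma partial_unit_closed [simp]: "s \<in> partial_units Q \<Longrightarrow> s \<in> carrier Q"
  by (simp add: partial_unit_iff)

lemma partial_unit_base [simp]:
  "s \<in> partial_units Q \<Longrightarrow> s \<cdot> s\<^sup>\<star> \<in> base Q"
  "s \<in> partial_units Q \<Longrightarrow> s\<^sup>\<star> \<cdot> s \<in> base Q"
  by (simp_all add: partial_unit_iff)

lemma partial_unit_star [simp]: "s \<in> partial_units Q \<Longrightarrow> s\<^sup>\<star> \<in> partial_units Q"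
  by (intro partial_unitI) auto

lemma partial_unit_down:
  assumes "s \<in> partial_units Q" "t \<in> carrier Q" "t \<sqsubseteq> s"
  shows "t \<in> partial_units Q"
  using assms base_down[of "s \<cdot> s\<^sup>\<star>" "t \<cdot> t\<^sup>\<star>"] base_down[of "s\<^sup>\<star> \<cdot> s" "t\<^sup>\<star> \<cdot> t"]
  by (intro partial_unitI) (auto simp: mult_mono star_mono)

lemma conj_base [simp]:
  assumes "s \<in> partial_units Q" "b \<in> base Q"
  shows "s \<cdot> (b \<cdot> s\<^sup>\<star>) \<in> base Q"
proof (rule base_down[of "s \<cdot> s\<^sup>\<star>"])
  show "s \<cdot> (b \<cdot> s\<^sup>\<star>) \<sqsubseteq> s \<cdot> s\<^sup>\<star>"
    using assms by (intro mult_mono base_mult_le) auto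
qed (use assms in auto)

lemma partial_unit_mult [simp]:
  assumes "s \<in> partial_units Q" "t \<in> partial_units Q"
  shows "s \<cdot> t \<in> partial_units Q"
  using assms conj_base[of s "t \<cdot> t\<^sup>\<star>"] conj_base[of "t\<^sup>\<star>" "s\<^sup>\<star> \<cdot> s"]
  by (intro partial_unitI) (simp_all add: star_mult mult_assoc)

end

context inverse_quantal_frame
begin

text \<open>
  The stable support forces \<open>a \<sqsubseteq> a \<cdot> a\<^sup>\<star> \<cdot> a\<close>.  This makes the base a locale with
  multiplication as meet and trivial involution, and the partial units an inverse monoid.
\<close>

lemma le_mult_star_mult:
  assumes "a \<in> carrier Q"
  shows "a \<sqsubseteq> a \<cdot> (a\<^sup>\<star> \<cdot> a)"
proof -
  obtain \<sigma> where \<sigma>: "stable_support Q \<sigma>" using stable_support_exists by blast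
  then have "\<sigma> a \<in> base Q" using assms by (auto simp: stable_support_def)
  then have c: "\<sigma> a \<in> carrier Q" by simp
  have "a \<sqsubseteq> \<sigma> a \<cdot> a" using \<sigma> assms by (simp add: stable_support_def)
  also have "\<dots> \<sqsubseteq> (a \<cdot> a\<^sup>\<star>) \<cdot> a"
    using \<sigma> assms c by (intro mult_mono) (auto simp: stable_support_def)
  finally show ?thesis using assms c by (simp add: mult_assoc)
qed

lemma base_star [simp]: "b \<in> base Q \<Longrightarrow> b\<^sup>\<star> = b"
proof -
  have *: "b \<sqsubseteq> b\<^sup>\<star>" if b: "b \<in> base Q" for b
  proof -
    have bs: "b\<^sup>\<star> \<in> base Q" using b star_mono[of b \<e>] by (intro baseI) (auto simp: base_le_unit)
    have "b \<sqsubseteq> b \<cdot> (b\<^sup>\<star> \<cdot> b)" using b by (simp add: le_mult_star_mult)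
    also have "\<dots> \<sqsubseteq> b\<^sup>\<star> \<cdot> b" using b bs by (intro base_mult_le) auto
    also have "\<dots> \<sqsubseteq> b\<^sup>\<star>" using b bs by (intro base_mult_le) auto
    finally show ?thesis using b by simp
  qed
  assume b: "b \<in> base Q"
  then show ?thesis using *[of b] star_le_iff[of b b] by (intro le_antisym) auto
qed

lemma base_commute: "\<lbrakk>b \<in> base Q; c \<in> base Q\<rbrakk> \<Longrightarrow> b \<cdot> c = c \<cdot> b"
  by (metis base_closed base_mult base_star star_mult)

lemma base_idem [simp]: "b \<in> base Q \<Longrightarrow> b \<cdot> b = b"
proof -
  assume b: "b \<in> base Q"
  have "b \<sqsubseteq> b \<cdot> (b \<cdot> b)" using le_mult_star_mult[of b] b by simp
  also have "\<dots> \<sqsubseteq> b \<cdot> b" using b by (intro base_mult_le) auto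
  finally show ?thesis using b by (intro le_antisym base_mult_le) auto
qed

lemma base_le_mult: "\<lbrakk>a \<in> base Q; b \<in> base Q; a \<sqsubseteq> b\<rbrakk> \<Longrightarrow> a \<cdot> b = a"
  using mult_mono[of a a a b] by (intro le_antisym base_mult_le) auto

lemma base_partial_unit [simp]: "b \<in> base Q \<Longrightarrow> b \<in> partial_units Q"
  by (intro partial_unitI) auto

lemma partial_unit_regular:
  assumes "s \<in> partial_units Q" shows "s \<cdot> (s\<^sup>\<star> \<cdot> s) = s"
  using assms by (intro le_antisym base_mult_le le_mult_star_mult) auto

text \<open>A stable support is left adjoint to \<open>b \<mapsto> b \<cdot> \<top>\<close>, hence unique.\<close>

lemma stable_support_le_iff:
  assumes \<sigma>: "stable_support Q \<sigma>" and a: "a \<in> carrier Q" and b: "b \<in> base Q"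
  shows "\<sigma> a \<sqsubseteq> b \<longleftrightarrow> a \<sqsubseteq> b \<cdot> \<top>"
proof
  have [simp]: "\<sigma> x \<in> base Q" if "x \<in> carrier Q" for x
    using \<sigma> that by (auto simp: stable_support_def)
  {
    assume "\<sigma> a \<sqsubseteq> b"
    have "a \<sqsubseteq> \<sigma> a \<cdot> a" using \<sigma> a by (simp add: stable_support_def)
    also have "\<dots> \<sqsubseteq> b \<cdot> \<top>" using a b \<open>\<sigma> a \<sqsubseteq> b\<close> by (intro mult_mono) auto
    finally show "a \<sqsubseteq> b \<cdot> \<top>" using a b by simp
  }
  assume le: "a \<sqsubseteq> b \<cdot> \<top>"
  have sp: "sup_pres Q (Q\<lparr>carrier := base Q\<rparr>) \<sigma>" using \<sigma> by (simp add: stable_support_def)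
  have "\<sigma> a \<sqsubseteq> \<sigma> (b \<cdot> \<top>)" using sup_pres_mono[OF sp, of a "b \<cdot> \<top>"] a b le by simp
  also have "\<dots> \<sqsubseteq> \<sigma> b" using \<sigma> b by (simp add: stable_support_def)
  also have "\<dots> \<sqsubseteq> b \<cdot> b\<^sup>\<star>" using \<sigma> base_closed[OF b] unfolding stable_support_def by blast
  finally show "\<sigma> a \<sqsubseteq> b" using a b by simp
qed

lemma qsupp_stable_support: "stable_support Q (qsupp Q)"
  unfolding qsupp_def
proof (rule theI'[where P = "stable_support Q"])
  have "\<sigma> = \<tau>" if \<sigma>: "stable_support Q \<sigma>" and \<tau>: "stable_support Q \<tau>" for \<sigma> \<tau>
  proof (rule extensionalityI[of _ "carrier Q"])
    show "\<sigma> \<in> extensional (carrier Q)" "\<tau> \<in> extensional (carrier Q)"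
      using \<sigma> \<tau> by (auto simp: stable_support_def PiE_def)
    fix a assume a: "a \<in> carrier Q"
    then have "\<sigma> a \<in> base Q" "\<tau> a \<in> base Q" using \<sigma> \<tau> by (auto simp: stable_support_def)
    then show "\<sigma> a = \<tau> a"
      using stable_support_le_iff[OF \<sigma> a] stable_support_le_iff[OF \<tau> a]
      by (metis base_closed le_antisym weak_refl refl)
  qed
  then show "\<exists>!\<sigma>. stable_support Q \<sigma>" using stable_support_exists by blast
qed

lemma qsupp_partial_unit:
  assumes s: "s \<in> partial_units Q" shows "qsupp Q s = s \<cdot> s\<^sup>\<star>"
proof (rule le_antisym)
  have b: "qsupp Q s \<in> base Q" "qsupp Q (s \<cdot> s\<^sup>\<star>) \<in> base Q"
    using qsupp_stable_support s by (auto simp: stable_support_def)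
  then show "qsupp Q s \<in> carrier Q" by simp
  show "qsupp Q s \<sqsubseteq> s \<cdot> s\<^sup>\<star>" using qsupp_stable_support s by (simp add: stable_support_def)
  have "s \<sqsubseteq> qsupp Q s \<cdot> s" using qsupp_stable_support s by (simp add: stable_support_def)
  then have "s \<cdot> s\<^sup>\<star> \<sqsubseteq> (qsupp Q s \<cdot> s) \<cdot> s\<^sup>\<star>" using s b by (intro mult_mono) auto
  also have "\<dots> \<sqsubseteq> qsupp Q s" using s b by (simp add: mult_assoc base_mult_le)
  finally show "s \<cdot> s\<^sup>\<star> \<sqsubseteq> qsupp Q s" using s b by simp
qed (use s in simp)

lemma Sup_partial_units_below:
  assumes a: "a \<in> carrier Q"
  shows "\<Squnion>{s \<in> partial_units Q. s \<sqsubseteq> a} = a"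
proof (rule le_antisym)
  let ?S = "{s \<in> partial_units Q. s \<sqsubseteq> a}"
  have S: "?S \<subseteq> carrier Q" by auto
  then show "\<Squnion>?S \<sqsubseteq> a" "\<Squnion>?S \<in> carrier Q" using a by (auto simp: sup_le_iff)
  have "\<Squnion>((\<lambda>s. a \<sqinter> s) ` partial_units Q) \<sqsubseteq> \<Squnion>?S"
  proof (rule sup_least)
    fix x assume "x \<in> (\<lambda>s. a \<sqinter> s) ` partial_units Q"
    then obtain s where s: "s \<in> partial_units Q" "x = a \<sqinter> s" by blast
    then have "x \<in> ?S" using a partial_unit_down[of s x] by (simp add: meet_left meet_right)
    then show "x \<sqsubseteq> \<Squnion>?S" by (intro sup_upper[OF S])
  qed (use a S in auto)
  then show "a \<sqsubseteq> \<Squnion>?S" using Sup_meet_cover[OF a Sup_partial_units] by (simp add: subsetI)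
qed (use a in simp)

end

section \<open>Sheaves and their inner products\<close>

text \<open>A sheaf \<open>X\<close> over an inverse quantal frame \<open>Q\<close>, with its left action.\<close>

locale quantal_sheaf = inverse_quantal_frame Q + X: frame X
  for Q :: "('q, 'm) iquantale_scheme" (structure) and X :: "('x, 'n) gorder_scheme" +
  fixes act :: "'q \<Rightarrow> 'x \<Rightarrow> 'x" (infixr \<open>\<bullet>\<close> 78)
  assumes left_sheaf: "left_sheaf Q X act"
begin

lemma module: "left_module Q X act" "left_locale Q X act"
  using left_sheaf unfolding left_sheaf_def left_locale_def by blast+

lemma act_closed [simp]: "\<lbrakk>a \<in> carrier Q; x \<in> carrier X\<rbrakk> \<Longrightarrow> a \<bullet> x \<in> carrier X"
  and act_unit [simp]: "x \<in> carrier X \<Longrightarrow> \<e> \<bullet> x = x"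
  and act_mult: "\<lbrakk>a \<in> carrier Q; b \<in> carrier Q; x \<in> carrier X\<rbrakk> \<Longrightarrow> (a \<cdot> b) \<bullet> x = a \<bullet> b \<bullet> x"
  and act_Sup_left: "x \<in> carrier X \<Longrightarrow> sup_pres Q X (\<lambda>a. a \<bullet> x)"
  and act_Sup_right: "a \<in> carrier Q \<Longrightarrow> sup_pres X X (act a)"
  using module(1) unfolding left_module_def by blast+

lemma act_mono:
  assumes "a \<sqsubseteq> b" "x \<sqsubseteq>\<^bsub>X\<^esub> y" "a \<in> carrier Q" "b \<in> carrier Q" "x \<in> carrier X" "y \<in> carrier X"
  shows "a \<bullet> x \<sqsubseteq>\<^bsub>X\<^esub> b \<bullet> y"
proof -
  have "a \<bullet> x \<sqsubseteq>\<^bsub>X\<^esub> b \<bullet> x" using assms by (intro sup_pres_mono[OF act_Sup_left[of x]]) auto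
  also have "b \<bullet> x \<sqsubseteq>\<^bsub>X\<^esub> b \<bullet> y" using assms by (intro sup_pres_mono[OF act_Sup_right[of b]]) auto
  finally show ?thesis using assms by simp
qed

lemma base_act_meet: "\<lbrakk>b \<in> base Q; x \<in> carrier X\<rbrakk> \<Longrightarrow> b \<bullet> x = b \<bullet> \<top>\<^bsub>X\<^esub> \<sqinter>\<^bsub>X\<^esub> x"
  using module(2) unfolding left_locale_def by blast

lemma base_act_le: "\<lbrakk>b \<in> base Q; x \<in> carrier X\<rbrakk> \<Longrightarrow> b \<bullet> x \<sqsubseteq>\<^bsub>X\<^esub> x"
  using act_mono[of b \<e> x x] by (simp add: base_le_unit)

lemma base_act_eq:
  assumes "b \<in> base Q" "x \<in> carrier X" "x \<sqsubseteq>\<^bsub>X\<^esub> b \<bullet> \<top>\<^bsub>X\<^esub>"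
  shows "b \<bullet> x = x"
proof (rule X.le_antisym)
  show "x \<sqsubseteq>\<^bsub>X\<^esub> b \<bullet> x"
    using assms by (subst base_act_meet) (auto intro: X.meet_le)
qed (use assms in \<open>auto intro: base_act_le\<close>)

subsection \<open>Support and local sections\<close>

text \<open>The support is left adjoint to \<open>b \<mapsto> b \<bullet> \<top>\<close>, which gives its uniqueness and makes it preserve
  joins.\<close>

lemma sheaf_support_le_iff:
  assumes \<sigma>: "sheaf_support Q X act \<sigma>" and x: "x \<in> carrier X" and b: "b \<in> base Q"
  shows "\<sigma> x \<sqsubseteq> b \<longleftrightarrow> x \<sqsubseteq>\<^bsub>X\<^esub> b \<bullet> \<top>\<^bsub>X\<^esub>"
proof
  have s: "\<sigma> x \<in> base Q" and sx: "\<sigma> x \<bullet> x = x" and eqv: "\<sigma> (b \<bullet> x) = b \<cdot> \<sigma> x"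
    using \<sigma> x b unfolding sheaf_support_def by blast+
  {
    assume "\<sigma> x \<sqsubseteq> b"
    then have "\<sigma> x \<bullet> x \<sqsubseteq>\<^bsub>X\<^esub> b \<bullet> \<top>\<^bsub>X\<^esub>" using s b x by (intro act_mono) auto
    then show "x \<sqsubseteq>\<^bsub>X\<^esub> b \<bullet> \<top>\<^bsub>X\<^esub>" using sx by simp
  }
  assume "x \<sqsubseteq>\<^bsub>X\<^esub> b \<bullet> \<top>\<^bsub>X\<^esub>"
  then have "b \<bullet> x = x" using x b by (intro base_act_eq)
  then have "b \<cdot> \<sigma> x = \<sigma> x" using eqv[symmetric] by simp
  then show "\<sigma> x \<sqsubseteq> b" using base_mult_le(2)[of "\<sigma> x" b] s b by simp
qed

abbreviation spt :: "'x \<Rightarrow> 'q" where "spt \<equiv> supp Q X act"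

lemma spt: "sheaf_support Q X act spt"
  unfolding supp_def
proof (rule theI'[where P = "sheaf_support Q X act"])
  have "\<sigma> = \<tau>" if \<sigma>: "sheaf_support Q X act \<sigma>" and \<tau>: "sheaf_support Q X act \<tau>" for \<sigma> \<tau>
  proof (rule extensionalityI[of _ "carrier X"])
    show "\<sigma> \<in> extensional (carrier X)" "\<tau> \<in> extensional (carrier X)"
      using \<sigma> \<tau> unfolding sheaf_support_def PiE_def by blast+
    fix a assume a: "a \<in> carrier X"
    then have "\<sigma> a \<in> base Q" "\<tau> a \<in> base Q" using \<sigma> \<tau> unfolding sheaf_support_def by blast+
    then show "\<sigma> a = \<tau> a"
      using sheaf_support_le_iff[OF \<sigma> a] sheaf_support_le_iff[OF \<tau> a]
      by (metis base_closed le_antisym weak_refl refl)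
  qed
  then show "\<exists>!\<sigma>. sheaf_support Q X act \<sigma>" using left_sheaf unfolding left_sheaf_def by blast
qed

lemma spt_base [simp]: "x \<in> carrier X \<Longrightarrow> spt x \<in> base Q"
  and spt_act_base: "\<lbrakk>b \<in> base Q; x \<in> carrier X\<rbrakk> \<Longrightarrow> spt (b \<bullet> x) = b \<cdot> spt x"
  and spt_act [simp]: "x \<in> carrier X \<Longrightarrow> spt x \<bullet> x = x"
  and spt_mono: "\<lbrakk>x \<in> carrier X; y \<in> carrier X; x \<sqsubseteq>\<^bsub>X\<^esub> y\<rbrakk> \<Longrightarrow> spt x \<sqsubseteq> spt y"
  using spt unfolding sheaf_support_def by blast+

lemmas spt_le_iff = sheaf_support_le_iff[OF spt]

lemma spt_Sup:
  assumes "A \<subseteq> carrier X" shows "spt (\<Squnion>\<^bsub>X\<^esub>A) = \<Squnion>(spt ` A)"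
proof (rule le_antisym)
  have b: "spt ` A \<subseteq> base Q" "spt ` A \<subseteq> carrier Q" using assms by auto
  have "a \<sqsubseteq>\<^bsub>X\<^esub> \<Squnion>(spt ` A) \<bullet> \<top>\<^bsub>X\<^esub>" if "a \<in> A" for a
    using spt_le_iff[of a "\<Squnion>(spt ` A)"] that assms b sup_upper[OF b(2), of "spt a"] by auto
  then show "spt (\<Squnion>\<^bsub>X\<^esub>A) \<sqsubseteq> \<Squnion>(spt ` A)"
    using assms b by (simp add: spt_le_iff X.sup_le_iff)
  show "\<Squnion>(spt ` A) \<sqsubseteq> spt (\<Squnion>\<^bsub>X\<^esub>A)"
    using assms by (intro sup_least) (auto intro!: spt_mono X.sup_upper)
qed (use assms in \<open>auto intro!: sup_closed\<close>)

abbreviation sections :: "'x set" (\<open>\<Gamma>\<close>) where "\<Gamma> \<equiv> local_sections Q X act"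

lemma section_closed [simp]: "s \<in> \<Gamma> \<Longrightarrow> s \<in> carrier X"
  unfolding local_sections_def by blast

lemma section_restrict: "\<lbrakk>s \<in> \<Gamma>; x \<in> carrier X; x \<sqsubseteq>\<^bsub>X\<^esub> s\<rbrakk> \<Longrightarrow> spt x \<bullet> s = x"
  unfolding local_sections_def by blast

lemma sectionI:
  "\<lbrakk>s \<in> carrier X; \<And>x. \<lbrakk>x \<in> carrier X; x \<sqsubseteq>\<^bsub>X\<^esub> s\<rbrakk> \<Longrightarrow> spt x \<bullet> s = x\<rbrakk> \<Longrightarrow> s \<in> \<Gamma>"
  unfolding local_sections_def by blast

lemma section_down:
  assumes s: "s \<in> \<Gamma>" and x: "x \<in> carrier X" "x \<sqsubseteq>\<^bsub>X\<^esub> s"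
  shows "x \<in> \<Gamma>"
proof (rule sectionI[OF x(1)])
  fix y assume y: "y \<in> carrier X" "y \<sqsubseteq>\<^bsub>X\<^esub> x"
  then have ys: "y \<sqsubseteq>\<^bsub>X\<^esub> s" using s x X.le_trans[of y x s] by simp
  have "spt y \<bullet> x = spt y \<bullet> spt x \<bullet> s" using section_restrict s x by simp
  also have "\<dots> = (spt y \<cdot> spt x) \<bullet> s" using s x y by (simp add: act_mult)
  also have "\<dots> = spt y \<bullet> s" using x y by (simp add: base_le_mult spt_mono)
  finally show "spt y \<bullet> x = y" using section_restrict[OF s y(1) ys] by simp
qed

lemma partial_unit_act_restrict:
  assumes "v \<in> partial_units Q" "x \<in> carrier X" "y \<in> carrier X" "y \<sqsubseteq>\<^bsub>X\<^esub> v \<bullet> x"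
  shows "v \<bullet> v\<^sup>\<star> \<bullet> y = y"
proof -
  have "v \<bullet> x = v \<bullet> v\<^sup>\<star> \<bullet> v \<bullet> x"
    using assms partial_unit_regular[of v] act_mult[of v "v\<^sup>\<star> \<cdot> v" x] act_mult[of "v\<^sup>\<star>" v x] by simp
  also have "\<dots> \<sqsubseteq>\<^bsub>X\<^esub> v \<bullet> v\<^sup>\<star> \<bullet> \<top>\<^bsub>X\<^esub>" using assms by (intro act_mono) auto
  finally have "y \<sqsubseteq>\<^bsub>X\<^esub> (v \<cdot> v\<^sup>\<star>) \<bullet> \<top>\<^bsub>X\<^esub>"
    using assms X.le_trans[of y "v \<bullet> x" "v \<bullet> v\<^sup>\<star> \<bullet> \<top>\<^bsub>X\<^esub>"] by (simp add: act_mult)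
  then show ?thesis using base_act_eq[of "v \<cdot> v\<^sup>\<star>" y] assms by (simp add: act_mult)
qed

lemma partial_unit_act_le:
  assumes "v \<in> partial_units Q" "x \<in> carrier X"
  shows "v \<bullet> v\<^sup>\<star> \<bullet> x \<sqsubseteq>\<^bsub>X\<^esub> x" and "v\<^sup>\<star> \<bullet> v \<bullet> x \<sqsubseteq>\<^bsub>X\<^esub> x"
  using base_act_le[of "v \<cdot> v\<^sup>\<star>" x] base_act_le[of "v\<^sup>\<star> \<cdot> v" x] assms by (simp_all add: act_mult)

lemma spt_partial_unit_act:
  assumes v: "v \<in> partial_units Q" and x: "x \<in> carrier X"
  shows "spt (v \<bullet> x) = v \<cdot> (spt x \<cdot> v\<^sup>\<star>)"
proof (rule le_antisym)
  have le: "spt (u \<bullet> z) \<sqsubseteq> u \<cdot> (spt z \<cdot> u\<^sup>\<star>)" if u: "u \<in> partial_units Q" and z: "z \<in> carrier X" for u z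
  proof -
    have "u \<bullet> z = (u \<cdot> (u\<^sup>\<star> \<cdot> u)) \<bullet> (spt z \<bullet> z)"
      using u z by (simp add: partial_unit_regular)
    also have "\<dots> = (u \<cdot> ((u\<^sup>\<star> \<cdot> u) \<cdot> spt z)) \<bullet> z"
      using u z by (simp add: act_mult)
    also have "\<dots> = (u \<cdot> (spt z \<cdot> (u\<^sup>\<star> \<cdot> u))) \<bullet> z"
      using u z by (simp only: base_commute spt_base partial_unit_base)
    also have "\<dots> = (u \<cdot> (spt z \<cdot> u\<^sup>\<star>)) \<bullet> (u \<bullet> z)"
      using u z by (simp add: act_mult)
    also have "\<dots> \<sqsubseteq>\<^bsub>X\<^esub> (u \<cdot> (spt z \<cdot> u\<^sup>\<star>)) \<bullet> \<top>\<^bsub>X\<^esub>" using u z by (intro act_mono) auto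
    finally show ?thesis using u z by (simp add: spt_le_iff)
  qed
  show "spt (v \<bullet> x) \<sqsubseteq> v \<cdot> (spt x \<cdot> v\<^sup>\<star>)" by (rule le[OF v x])
  have b: "spt (v \<bullet> x) \<in> base Q" "spt x \<in> base Q" using v x by simp_all
  have "(v\<^sup>\<star> \<cdot> v) \<cdot> spt x \<sqsubseteq> v\<^sup>\<star> \<cdot> (spt (v \<bullet> x) \<cdot> v)"
    using le[of "v\<^sup>\<star>" "v \<bullet> x"] v x spt_act_base[of "v\<^sup>\<star> \<cdot> v" x] by (simp add: act_mult)
  then have "((v\<^sup>\<star> \<cdot> v) \<cdot> spt x) \<cdot> v\<^sup>\<star> \<sqsubseteq> (v\<^sup>\<star> \<cdot> (spt (v \<bullet> x) \<cdot> v)) \<cdot> v\<^sup>\<star>"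
    by (rule mult_mono) (use v x b in auto)
  then have "v \<cdot> (((v\<^sup>\<star> \<cdot> v) \<cdot> spt x) \<cdot> v\<^sup>\<star>) \<sqsubseteq> v \<cdot> ((v\<^sup>\<star> \<cdot> (spt (v \<bullet> x) \<cdot> v)) \<cdot> v\<^sup>\<star>)"
    by (rule mult_mono[rotated]) (use v x b in auto)
  also have "\<dots> = (v \<cdot> v\<^sup>\<star>) \<cdot> (spt (v \<bullet> x) \<cdot> (v \<cdot> v\<^sup>\<star>))"
    using v x b by (simp add: mult_assoc)
  also have "\<dots> \<sqsubseteq> spt (v \<bullet> x) \<cdot> (v \<cdot> v\<^sup>\<star>)" using v x b by (intro base_mult_le) auto
  also have "\<dots> \<sqsubseteq> spt (v \<bullet> x)" using v x b by (intro base_mult_le) auto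
  finally have "v \<cdot> (((v\<^sup>\<star> \<cdot> v) \<cdot> spt x) \<cdot> v\<^sup>\<star>) \<sqsubseteq> spt (v \<bullet> x)" using v x b by simp
  moreover have "v \<cdot> (((v\<^sup>\<star> \<cdot> v) \<cdot> spt x) \<cdot> v\<^sup>\<star>) = (v \<cdot> (v\<^sup>\<star> \<cdot> v)) \<cdot> (spt x \<cdot> v\<^sup>\<star>)"
    using v x b by (simp add: mult_assoc)
  ultimately show "v \<cdot> (spt x \<cdot> v\<^sup>\<star>) \<sqsubseteq> spt (v \<bullet> x)" using v by (simp add: partial_unit_regular)
qed (use v x in auto)

lemma partial_unit_act_section:
  assumes v: "v \<in> partial_units Q" and t: "t \<in> \<Gamma>"
  shows "v \<bullet> t \<in> \<Gamma>"
proof (rule sectionI)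
  fix y assume y: "y \<in> carrier X" "y \<sqsubseteq>\<^bsub>X\<^esub> v \<bullet> t"
  let ?z = "v\<^sup>\<star> \<bullet> y"
  have vz: "v \<bullet> ?z = y" using partial_unit_act_restrict[of v t y] v t y by simp
  have "?z \<sqsubseteq>\<^bsub>X\<^esub> v\<^sup>\<star> \<bullet> v \<bullet> t" using v t y by (intro act_mono) auto
  also have "\<dots> \<sqsubseteq>\<^bsub>X\<^esub> t" using v t by (simp add: partial_unit_act_le)
  finally have zt: "spt ?z \<bullet> t = ?z" using v t y by (intro section_restrict) auto
  have b: "spt ?z \<in> base Q" using v y by simp
  have "spt y \<bullet> v \<bullet> t = spt (v \<bullet> ?z) \<bullet> v \<bullet> t" using vz by simp
  also have "\<dots> = (v \<cdot> (spt ?z \<cdot> v\<^sup>\<star>)) \<bullet> v \<bullet> t"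
    using v y by (subst spt_partial_unit_act) auto
  also have "\<dots> = v \<bullet> (spt ?z \<cdot> (v\<^sup>\<star> \<cdot> v)) \<bullet> t"
    using v t b by (simp add: act_mult)
  also have "\<dots> = v \<bullet> ((v\<^sup>\<star> \<cdot> v) \<cdot> spt ?z) \<bullet> t"
    using v b by (simp only: base_commute partial_unit_base)
  also have "\<dots> = (v \<cdot> (v\<^sup>\<star> \<cdot> v)) \<bullet> spt ?z \<bullet> t"
    using v t b by (simp add: act_mult)
  also have "\<dots> = y" using zt vz v by (simp add: partial_unit_regular)
  finally show "spt y \<bullet> v \<bullet> t = y" .
qed (use v t in simp)

lemma section_Sup:
  assumes x: "x \<in> carrier X"
  shows "\<Squnion>\<^bsub>X\<^esub>{s \<in> \<Gamma>. s \<sqsubseteq>\<^bsub>X\<^esub> x} = x"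
proof (rule X.le_antisym)
  let ?S = "{s \<in> \<Gamma>. s \<sqsubseteq>\<^bsub>X\<^esub> x}"
  have S: "?S \<subseteq> carrier X" by auto
  then show "\<Squnion>\<^bsub>X\<^esub>?S \<sqsubseteq>\<^bsub>X\<^esub> x" "\<Squnion>\<^bsub>X\<^esub>?S \<in> carrier X" using x by (auto simp: X.sup_le_iff)
  have "\<Squnion>\<^bsub>X\<^esub>((\<lambda>s. x \<sqinter>\<^bsub>X\<^esub> s) ` \<Gamma>) \<sqsubseteq>\<^bsub>X\<^esub> \<Squnion>\<^bsub>X\<^esub>?S"
  proof (rule X.sup_least)
    fix y assume "y \<in> (\<lambda>s. x \<sqinter>\<^bsub>X\<^esub> s) ` \<Gamma>"
    then obtain s where s: "s \<in> \<Gamma>" "y = x \<sqinter>\<^bsub>X\<^esub> s" by blast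
    then have "y \<in> ?S" using x section_down[of s y] by (simp add: X.meet_left X.meet_right)
    then show "y \<sqsubseteq>\<^bsub>X\<^esub> \<Squnion>\<^bsub>X\<^esub>?S" by (intro X.sup_upper[OF S])
  qed (use x S in auto)
  moreover have "\<Squnion>\<^bsub>X\<^esub>\<Gamma> = \<top>\<^bsub>X\<^esub>" using left_sheaf by (simp add: left_sheaf_def)
  ultimately show "x \<sqsubseteq>\<^bsub>X\<^esub> \<Squnion>\<^bsub>X\<^esub>?S" using X.Sup_meet_cover[OF x, of \<Gamma>] by (simp add: subsetI)
qed (use x in simp)

end

context quantal_sheaf
begin

subsection \<open>An explicit inner product\<close>

text \<open>
  The inner product of arbitrary elements \<open>x\<close> and \<open>y\<close> is given at once, as the join of the partial
  units \<open>v\<close> that carry some local section \<open>t\<close> below \<open>y\<close>, whose support contains their domain \<open>v\<^sup>\<star> \<cdot> v\<close>,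
  into \<open>x\<close>.  For local sections \<open>x\<close> and \<open>y\<close> this is the set of partial units in the definition of
  the inner product, since one can then take \<open>t = y\<close>.
\<close>

definition ip_units :: "'x \<Rightarrow> 'x \<Rightarrow> 'q set" where
  "ip_units x y =
     {v \<in> partial_units Q. \<exists>t\<in>\<Gamma>. t \<sqsubseteq>\<^bsub>X\<^esub> y \<and> v\<^sup>\<star> \<cdot> v \<sqsubseteq> spt t \<and> v \<bullet> t \<sqsubseteq>\<^bsub>X\<^esub> x}"

definition ip :: "'x \<Rightarrow> 'x \<Rightarrow> 'q" where
  "ip x y = \<Squnion>(ip_units x y)"

lemma ip_unitsI:
  "\<lbrakk>v \<in> partial_units Q; t \<in> \<Gamma>; t \<sqsubseteq>\<^bsub>X\<^esub> y; v\<^sup>\<star> \<cdot> v \<sqsubseteq> spt t; v \<bullet> t \<sqsubseteq>\<^bsub>X\<^esub> x\<rbrakk> \<Longrightarrow> v \<in> ip_units x y"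
  unfolding ip_units_def by blast

lemma ip_unitsE:
  assumes "v \<in> ip_units x y"
  obtains t where "v \<in> partial_units Q" "t \<in> \<Gamma>" "t \<sqsubseteq>\<^bsub>X\<^esub> y" "v\<^sup>\<star> \<cdot> v \<sqsubseteq> spt t" "v \<bullet> t \<sqsubseteq>\<^bsub>X\<^esub> x"
  using assms unfolding ip_units_def by blast

lemma ip_units_closed: "ip_units x y \<subseteq> carrier Q"
  by (auto elim: ip_unitsE)

lemma ip_closed [simp]: "ip x y \<in> carrier Q"
  by (simp add: ip_def ip_units_closed)

lemma le_ip: "v \<in> ip_units x y \<Longrightarrow> v \<sqsubseteq> ip x y"
  unfolding ip_def by (rule sup_upper[OF ip_units_closed])

lemma ip_le: "\<lbrakk>c \<in> carrier Q; \<And>v. v \<in> ip_units x y \<Longrightarrow> v \<sqsubseteq> c\<rbrakk> \<Longrightarrow> ip x y \<sqsubseteq> c"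
  unfolding ip_def by (rule sup_least[OF ip_units_closed])

lemma ip_units_mono:
  assumes "x \<in> carrier X" "x' \<in> carrier X" "x \<sqsubseteq>\<^bsub>X\<^esub> x'" "y \<in> carrier X" "y' \<in> carrier X" "y \<sqsubseteq>\<^bsub>X\<^esub> y'"
  shows "ip_units x y \<subseteq> ip_units x' y'"
proof
  fix v assume "v \<in> ip_units x y"
  then obtain t where t: "v \<in> partial_units Q" "t \<in> \<Gamma>" "t \<sqsubseteq>\<^bsub>X\<^esub> y" "v\<^sup>\<star> \<cdot> v \<sqsubseteq> spt t" "v \<bullet> t \<sqsubseteq>\<^bsub>X\<^esub> x"
    by (rule ip_unitsE)
  then show "v \<in> ip_units x' y'"
    using assms X.le_trans[of t y y'] X.le_trans[of "v \<bullet> t" x x'] by (intro ip_unitsI[of v t]) auto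
qed

lemma ip_mono:
  assumes "x \<in> carrier X" "x' \<in> carrier X" "x \<sqsubseteq>\<^bsub>X\<^esub> x'" "y \<in> carrier X" "y' \<in> carrier X" "y \<sqsubseteq>\<^bsub>X\<^esub> y'"
  shows "ip x y \<sqsubseteq> ip x' y'"
  using ip_units_mono[OF assms] by (intro ip_le le_ip) auto

text \<open>The range of \<open>v\<close> lies below the support of \<open>v \<bullet> t\<close> as soon as its domain lies below the
  support of \<open>t\<close>.\<close>

lemma range_le_spt:
  assumes "v \<in> partial_units Q" "t \<in> carrier X" "v\<^sup>\<star> \<cdot> v \<sqsubseteq> spt t"
  shows "v \<cdot> v\<^sup>\<star> \<sqsubseteq> spt (v \<bullet> t)"
proof -
  have "(v\<^sup>\<star> \<cdot> v) \<cdot> v\<^sup>\<star> \<sqsubseteq> spt t \<cdot> v\<^sup>\<star>" using assms by (intro mult_mono) auto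
  then have "v \<cdot> ((v\<^sup>\<star> \<cdot> v) \<cdot> v\<^sup>\<star>) \<sqsubseteq> v \<cdot> (spt t \<cdot> v\<^sup>\<star>)"
    by (rule mult_mono[rotated]) (use assms in auto)
  moreover have "v \<cdot> ((v\<^sup>\<star> \<cdot> v) \<cdot> v\<^sup>\<star>) = v \<cdot> v\<^sup>\<star>"
    using partial_unit_regular[of "v\<^sup>\<star>"] assms(1) by (simp add: mult_assoc)
  ultimately show ?thesis using assms by (simp add: spt_partial_unit_act)
qed

lemma partial_unit_spt:
  assumes "v \<in> partial_units Q" "t \<in> carrier X" "v\<^sup>\<star> \<cdot> v \<sqsubseteq> spt t"
  shows "spt (v \<bullet> t) \<cdot> v = v" and "v \<cdot> spt t = v"
proof -
  have "v = (v \<cdot> v\<^sup>\<star>) \<cdot> v" using assms by (simp add: mult_assoc partial_unit_regular)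
  also have "\<dots> \<sqsubseteq> spt (v \<bullet> t) \<cdot> v" using assms range_le_spt[of v t] by (intro mult_mono) auto
  finally show "spt (v \<bullet> t) \<cdot> v = v" using assms by (intro le_antisym base_mult_le) auto
  have "v = v \<cdot> (v\<^sup>\<star> \<cdot> v)" using assms by (simp add: partial_unit_regular)
  also have "\<dots> \<sqsubseteq> v \<cdot> spt t" using assms by (intro mult_mono) auto
  finally show "v \<cdot> spt t = v" using assms by (intro le_antisym base_mult_le) auto
qed

lemma ip_units_star:
  assumes "v \<in> ip_units x y" "x \<in> carrier X" "y \<in> carrier X"
  shows "v\<^sup>\<star> \<in> ip_units y x"
proof -
  from assms(1) obtain t where t: "v \<in> partial_units Q" "t \<in> \<Gamma>" "t \<sqsubseteq>\<^bsub>X\<^esub> y" "v\<^sup>\<star> \<cdot> v \<sqsubseteq> spt t" "v \<bullet> t \<sqsubseteq>\<^bsub>X\<^esub> x"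
    by (rule ip_unitsE)
  show ?thesis
  proof (rule ip_unitsI[of _ "v \<bullet> t"])
    show "v\<^sup>\<star> \<bullet> v \<bullet> t \<sqsubseteq>\<^bsub>X\<^esub> y"
      using t assms partial_unit_act_le(2)[of v t] X.le_trans[of "v\<^sup>\<star> \<bullet> v \<bullet> t" t y] by auto
    show "(v\<^sup>\<star>)\<^sup>\<star> \<cdot> v\<^sup>\<star> \<sqsubseteq> spt (v \<bullet> t)" using t by (simp add: range_le_spt)
  qed (use t in \<open>auto intro: partial_unit_act_section\<close>)
qed

lemma ip_star:
  assumes "x \<in> carrier X" "y \<in> carrier X"
  shows "(ip x y)\<^sup>\<star> = ip y x"
proof -
  have *: "ip x y \<sqsubseteq> (ip y x)\<^sup>\<star>" if "x \<in> carrier X" "y \<in> carrier X" for x y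
  proof (rule ip_le)
    fix v assume v: "v \<in> ip_units x y"
    then have "v\<^sup>\<star> \<sqsubseteq> ip y x" using ip_units_star le_ip that by blast
    moreover have "v \<in> carrier Q" using v ip_units_closed by blast
    ultimately show "v \<sqsubseteq> (ip y x)\<^sup>\<star>" using star_le_iff[of v "ip y x"] by simp
  qed simp
  show ?thesis
    using *[of x y] *[of y x] assms by (intro le_antisym) (auto simp: star_le_iff)
qed

lemma ip_Sup_left:
  assumes A: "A \<subseteq> carrier X" and y: "y \<in> carrier X"
  shows "ip (\<Squnion>\<^bsub>X\<^esub>A) y = \<Squnion>((\<lambda>x. ip x y) ` A)"
proof (rule le_antisym)
  let ?c = "\<Squnion>((\<lambda>x. ip x y) ` A)"
  have C: "(\<lambda>x. ip x y) ` A \<subseteq> carrier Q" by auto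
  then show c: "?c \<in> carrier Q" by simp
  show "ip (\<Squnion>\<^bsub>X\<^esub>A) y \<sqsubseteq> ?c"
  proof (rule ip_le[OF c])
    fix v assume "v \<in> ip_units (\<Squnion>\<^bsub>X\<^esub>A) y"
    then obtain t where t: "v \<in> partial_units Q" "t \<in> \<Gamma>" "t \<sqsubseteq>\<^bsub>X\<^esub> y" "v\<^sup>\<star> \<cdot> v \<sqsubseteq> spt t"
      "v \<bullet> t \<sqsubseteq>\<^bsub>X\<^esub> \<Squnion>\<^bsub>X\<^esub>A" by (rule ip_unitsE)
    have vt: "v \<bullet> t \<in> \<Gamma>" using t by (simp add: partial_unit_act_section)
    \<comment> \<open>Cut \<open>v\<close> down to the parts of \<open>v \<bullet> t\<close> that lie below the individual members of \<open>A\<close>.\<close>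
    define m where "m a = v \<bullet> t \<sqinter>\<^bsub>X\<^esub> a" for a
    have m: "m a \<in> carrier X" "m a \<sqsubseteq>\<^bsub>X\<^esub> v \<bullet> t" "m a \<sqsubseteq>\<^bsub>X\<^esub> a" if "a \<in> A" for a
      using that A t by (auto simp: m_def intro!: X.meet_left X.meet_right)
    have part: "spt (m a) \<cdot> v \<sqsubseteq> ?c" if a: "a \<in> A" for a
    proof -
      have w: "spt (m a) \<cdot> v \<in> partial_units Q" using m a t by simp
      have dom: "(spt (m a) \<cdot> v)\<^sup>\<star> \<cdot> (spt (m a) \<cdot> v) \<sqsubseteq> v\<^sup>\<star> \<cdot> v"
        using m[OF a] t by (intro mult_mono star_mono base_mult_le) auto
      have "spt (m a) \<cdot> v \<in> ip_units a y"
      proof (rule ip_unitsI[OF w t(2,3)])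
        show "(spt (m a) \<cdot> v)\<^sup>\<star> \<cdot> (spt (m a) \<cdot> v) \<sqsubseteq> spt t"
          using dom t(4) w t(1,2) by (rule_tac le_trans) auto
        show "(spt (m a) \<cdot> v) \<bullet> t \<sqsubseteq>\<^bsub>X\<^esub> a"
          using section_restrict[OF vt] m[OF a] t by (simp add: act_mult)
      qed
      then show ?thesis using a C w by (intro le_sup_I[OF C, of "ip a y"] le_ip) auto
    qed
    have mA: "m ` A \<subseteq> carrier X" using m by auto
    have "v \<bullet> t = \<Squnion>\<^bsub>X\<^esub>(m ` A)"
      using X.meet_Sup[of "v \<bullet> t" A] A t X.meet_eq_left[of "v \<bullet> t" "\<Squnion>\<^bsub>X\<^esub>A"] by (simp add: m_def[abs_def])
    then have "spt (v \<bullet> t) = \<Squnion>(spt ` m ` A)" using spt_Sup[OF mA] by simp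
    then have "v = \<Squnion>(spt ` m ` A) \<cdot> v" using partial_unit_spt(1)[of v t] t by simp
    also have "\<dots> = \<Squnion>((\<lambda>b. b \<cdot> v) ` spt ` m ` A)"
      using m t by (intro sup_presD[OF mult_Sup_left]) auto
    also have "\<dots> \<sqsubseteq> ?c" using part c m t by (intro sup_least) auto
    finally show "v \<sqsubseteq> ?c" .
  qed
  show "?c \<sqsubseteq> ip (\<Squnion>\<^bsub>X\<^esub>A) y"
    using C A y by (intro sup_least) (auto intro!: ip_mono X.sup_upper)
qed simp

lemma ip_Sup_right:
  assumes A: "A \<subseteq> carrier X" and x: "x \<in> carrier X"
  shows "ip x (\<Squnion>\<^bsub>X\<^esub>A) = \<Squnion>((\<lambda>y. ip x y) ` A)"
proof -
  have "ip x (\<Squnion>\<^bsub>X\<^esub>A) = (\<Squnion>((\<lambda>y. ip y x) ` A))\<^sup>\<star>"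
    using assms by (simp add: ip_Sup_left flip: ip_star[of "\<Squnion>\<^bsub>X\<^esub>A" x])
  also have "\<dots> = \<Squnion>((\<lambda>a. a\<^sup>\<star>) ` (\<lambda>y. ip y x) ` A)"
    by (intro sup_presD[OF star_Sup]) auto
  also have "(\<lambda>a. a\<^sup>\<star>) ` (\<lambda>y. ip y x) ` A = (\<lambda>y. ip x y) ` A"
    unfolding image_image using assms by (intro image_cong) (auto simp: ip_star)
  finally show ?thesis .
qed

lemma sup_pres_ip:
  assumes "x \<in> carrier X"
  shows "sup_pres X Q (\<lambda>y. ip x y)" "sup_pres X Q (\<lambda>y. ip y x)"
  using assms unfolding sup_pres_def
  by (auto simp: ip_Sup_left ip_Sup_right X.complete_lattice_axioms complete_lattice_axioms)

lemma ip_partial_unit_act: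
  assumes u: "u \<in> partial_units Q" and x: "x \<in> carrier X" and y: "y \<in> carrier X"
  shows "ip (u \<bullet> x) y = u \<cdot> ip x y"
proof (rule le_antisym)
  have image: "u \<cdot> v \<in> ip_units (u \<bullet> x) y"
    if "v \<in> ip_units x y" "u \<in> partial_units Q" "x \<in> carrier X" for u v x
  proof -
    from that(1) obtain t where t: "v \<in> partial_units Q" "t \<in> \<Gamma>" "t \<sqsubseteq>\<^bsub>X\<^esub> y" "v\<^sup>\<star> \<cdot> v \<sqsubseteq> spt t"
      "v \<bullet> t \<sqsubseteq>\<^bsub>X\<^esub> x" by (rule ip_unitsE)
    show ?thesis
    proof (rule ip_unitsI[OF _ t(2,3)])
      have "(u \<cdot> v)\<^sup>\<star> \<cdot> (u \<cdot> v) = v\<^sup>\<star> \<cdot> ((u\<^sup>\<star> \<cdot> u) \<cdot> v)"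
        using that t by (simp add: star_mult mult_assoc)
      also have "\<dots> \<sqsubseteq> v\<^sup>\<star> \<cdot> v" using that t by (intro mult_mono base_mult_le) auto
      also have "\<dots> \<sqsubseteq> spt t" by (rule t)
      finally show "(u \<cdot> v)\<^sup>\<star> \<cdot> (u \<cdot> v) \<sqsubseteq> spt t" using that t by simp
      show "(u \<cdot> v) \<bullet> t \<sqsubseteq>\<^bsub>X\<^esub> u \<bullet> x" using that t by (simp add: act_mult act_mono)
    qed (use that t in simp)
  qed
  show "ip (u \<bullet> x) y \<sqsubseteq> u \<cdot> ip x y"
  proof (rule ip_le)
    fix v assume v: "v \<in> ip_units (u \<bullet> x) y"
    then obtain t where t: "v \<in> partial_units Q" "t \<in> \<Gamma>" "t \<sqsubseteq>\<^bsub>X\<^esub> y" "v\<^sup>\<star> \<cdot> v \<sqsubseteq> spt t"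
      "v \<bullet> t \<sqsubseteq>\<^bsub>X\<^esub> u \<bullet> x" by (rule ip_unitsE)
    have "u\<^sup>\<star> \<cdot> v \<in> ip_units (u\<^sup>\<star> \<bullet> u \<bullet> x) y" using image[OF v, of "u\<^sup>\<star>"] u x by simp
    then have "u\<^sup>\<star> \<cdot> v \<in> ip_units x y"
      using ip_units_mono[of "u\<^sup>\<star> \<bullet> u \<bullet> x" x y y] u x y by (auto simp: partial_unit_act_le)
    then have "u \<cdot> (u\<^sup>\<star> \<cdot> v) \<sqsubseteq> u \<cdot> ip x y" using u t by (intro mult_mono le_ip) auto
    moreover have "u \<cdot> (u\<^sup>\<star> \<cdot> v) = v"
    proof -
      have b: "spt (v \<bullet> t) \<in> base Q" "u \<cdot> u\<^sup>\<star> \<in> base Q" using u t by simp_all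
      have "u \<cdot> (spt x \<cdot> u\<^sup>\<star>) \<sqsubseteq> u \<cdot> u\<^sup>\<star>" using u x by (intro mult_mono base_mult_le) auto
      moreover have "spt (v \<bullet> t) \<sqsubseteq> u \<cdot> (spt x \<cdot> u\<^sup>\<star>)"
        using spt_mono[of "v \<bullet> t" "u \<bullet> x"] u x t by (simp add: spt_partial_unit_act)
      ultimately have "spt (v \<bullet> t) \<sqsubseteq> u \<cdot> u\<^sup>\<star>" using u x t
        by (rule_tac le_trans[of _ "u \<cdot> (spt x \<cdot> u\<^sup>\<star>)"]) auto
      then have "(u \<cdot> u\<^sup>\<star>) \<cdot> spt (v \<bullet> t) = spt (v \<bullet> t)"
        using base_le_mult[OF b] base_commute[OF b] by metis
      then have "(u \<cdot> u\<^sup>\<star>) \<cdot> (spt (v \<bullet> t) \<cdot> v) = spt (v \<bullet> t) \<cdot> v"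
        using u t b by (simp flip: mult_assoc)
      then show ?thesis using partial_unit_spt(1)[of v t] u t by (simp add: mult_assoc)
    qed
    ultimately show "v \<sqsubseteq> u \<cdot> ip x y" by simp
  qed (use u in simp)
  have "u \<cdot> ip x y = \<Squnion>((\<lambda>v. u \<cdot> v) ` ip_units x y)"
    unfolding ip_def using u ip_units_closed by (intro sup_presD[OF mult_Sup_right]) auto
  also have "\<dots> \<sqsubseteq> ip (u \<bullet> x) y"
    using image u x by (intro sup_least) (auto intro!: le_ip mult_closed elim: ip_unitsE)
  finally show "u \<cdot> ip x y \<sqsubseteq> ip (u \<bullet> x) y" .
qed (use u in auto)

lemma ip_act_left:
  assumes a: "a \<in> carrier Q" and x: "x \<in> carrier X" and y: "y \<in> carrier X"
  shows "ip (a \<bullet> x) y = a \<cdot> ip x y"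
proof -
  let ?S = "{s \<in> partial_units Q. s \<sqsubseteq> a}"
  have S: "?S \<subseteq> carrier Q" by auto
  have "ip (a \<bullet> x) y = ip (\<Squnion>\<^bsub>X\<^esub>((\<lambda>s. s \<bullet> x) ` ?S)) y"
    using sup_presD[OF act_Sup_left[OF x] S] a by (simp add: Sup_partial_units_below)
  also have "\<dots> = \<Squnion>((\<lambda>x. ip x y) ` (\<lambda>s. s \<bullet> x) ` ?S)"
    using x y by (intro ip_Sup_left) auto
  also have "(\<lambda>x. ip x y) ` (\<lambda>s. s \<bullet> x) ` ?S = (\<lambda>s. s \<cdot> ip x y) ` ?S"
    unfolding image_image using x y by (intro image_cong) (auto simp: ip_partial_unit_act)
  also have "\<Squnion>\<dots> = a \<cdot> ip x y"
    using sup_presD[OF mult_Sup_left[of "ip x y"] S] a by (simp add: Sup_partial_units_below)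
  finally show ?thesis .
qed

lemma ip_act_right:
  assumes a: "a \<in> carrier Q" and x: "x \<in> carrier X" and y: "y \<in> carrier X"
  shows "ip x (a \<bullet> y) = ip x y \<cdot> a\<^sup>\<star>"
proof -
  have "ip x (a \<bullet> y) = (a \<cdot> ip y x)\<^sup>\<star>"
    using assms by (simp add: ip_act_left flip: ip_star[of "a \<bullet> y" x])
  also have "\<dots> = ip x y \<cdot> a\<^sup>\<star>" using assms by (simp add: star_mult ip_star)
  finally show ?thesis .
qed

lemma ip_units_sections:
  assumes s: "s \<in> \<Gamma>" and t: "t \<in> \<Gamma>"
  shows "ip_units s t =
    {v \<in> partial_units Q. qsupp Q v \<sqsubseteq> spt s \<and> qsupp Q (v\<^sup>\<star>) \<sqsubseteq> spt t \<and> v \<bullet> t \<sqsubseteq>\<^bsub>X\<^esub> s}"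
    (is "_ = ?U")
proof (intro equalityI subsetI)
  fix v assume "v \<in> ip_units s t"
  then obtain t' where t': "v \<in> partial_units Q" "t' \<in> \<Gamma>" "t' \<sqsubseteq>\<^bsub>X\<^esub> t" "v\<^sup>\<star> \<cdot> v \<sqsubseteq> spt t'"
    "v \<bullet> t' \<sqsubseteq>\<^bsub>X\<^esub> s" by (rule ip_unitsE)
  have "v\<^sup>\<star> \<cdot> v \<sqsubseteq> spt t" using t' t spt_mono[of t' t] le_trans[of "v\<^sup>\<star> \<cdot> v" "spt t'" "spt t"] by simp
  moreover have "v \<cdot> v\<^sup>\<star> \<sqsubseteq> spt s"
    using t' s range_le_spt[of v t'] spt_mono[of "v \<bullet> t'" s] le_trans[of "v \<cdot> v\<^sup>\<star>" "spt (v \<bullet> t')" "spt s"]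
    by simp
  moreover have "v \<bullet> t = v \<bullet> t'"
  proof -
    have "v \<bullet> t = (v \<cdot> spt t') \<bullet> t" using t' by (simp add: partial_unit_spt(2))
    also have "\<dots> = v \<bullet> t'" using t' t section_restrict[OF t, of t'] by (simp add: act_mult)
    finally show ?thesis .
  qed
  ultimately show "v \<in> ?U" using t' by (simp add: qsupp_partial_unit)
next
  fix v assume "v \<in> ?U"
  then show "v \<in> ip_units s t" using t by (intro ip_unitsI[of v t]) (auto simp: qsupp_partial_unit)
qed

lemma is_inner_product_unique:
  assumes f: "is_inner_product Q X act f" and g: "is_inner_product Q X act g"
  shows "f = g"
proof (rule extensionalityI[of _ "carrier X \<times> carrier X"])
  show "f \<in> extensional (carrier X \<times> carrier X)" "g \<in> extensional (carrier X \<times> carrier X)"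
    using f g unfolding is_inner_product_def PiE_def by blast+
  fix p assume "p \<in> carrier X \<times> carrier X"
  then obtain x y where p: "p = (x, y)" "x \<in> carrier X" "y \<in> carrier X" by auto
  let ?S = "{s \<in> \<Gamma>. s \<sqsubseteq>\<^bsub>X\<^esub> x}" and ?T = "{s \<in> \<Gamma>. s \<sqsubseteq>\<^bsub>X\<^esub> y}"
  have ST: "?S \<subseteq> carrier X" "?T \<subseteq> carrier X" by auto
  have expand: "h (x, y) = \<Squnion>((\<lambda>s. \<Squnion>((\<lambda>t. \<Squnion>(ip_units s t)) ` ?T)) ` ?S)"
    if h: "is_inner_product Q X act h" for h
  proof -
    have l: "sup_pres X Q (\<lambda>x. h (x, y))" and r: "\<And>x. x \<in> carrier X \<Longrightarrow> sup_pres X Q (\<lambda>y. h (x, y))"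
      using h p unfolding is_inner_product_def by blast+
    have st: "h (s, t) = \<Squnion>(ip_units s t)" if "s \<in> \<Gamma>" "t \<in> \<Gamma>" for s t
      using h that by (simp add: ip_units_sections is_inner_product_def)
    have "h (x, y) = \<Squnion>((\<lambda>s. h (s, y)) ` ?S)"
      using sup_presD[OF l ST(1)] p by (simp add: section_Sup)
    also have "(\<lambda>s. h (s, y)) ` ?S = (\<lambda>s. \<Squnion>((\<lambda>t. \<Squnion>(ip_units s t)) ` ?T)) ` ?S"
    proof (rule image_cong[OF HOL.refl])
      fix s assume s: "s \<in> ?S"
      then have "h (s, y) = \<Squnion>((\<lambda>t. h (s, t)) ` ?T)"
        using sup_presD[OF r ST(2), of s] p by (simp add: section_Sup)
      also have "(\<lambda>t. h (s, t)) ` ?T = (\<lambda>t. \<Squnion>(ip_units s t)) ` ?T"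
        using s st by (intro image_cong) auto
      finally show "h (s, y) = \<Squnion>((\<lambda>t. \<Squnion>(ip_units s t)) ` ?T)" .
    qed
    finally show ?thesis .
  qed
  show "f p = g p" unfolding p(1) using expand[OF f] expand[OF g] by simp
qed

lemma inner_product_eq:
  assumes "x \<in> carrier X" "y \<in> carrier X"
  shows "inner_product Q X act (x, y) = ip x y"
proof -
  let ?f = "restrict (\<lambda>(x, y). ip x y) (carrier X \<times> carrier X)"
  have sp: "sup_pres X Q (\<lambda>x. ?f (x, y))" "sup_pres X Q (\<lambda>x. ?f (y, x))" if "y \<in> carrier X" for y
    using sup_pres_ip[OF that] that unfolding sup_pres_def by (auto simp: subset_iff cong: image_cong)
  have "is_inner_product Q X act ?f"
    unfolding is_inner_product_def
  proof (intro conjI ballI)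
    fix s t assume "s \<in> \<Gamma>" "t \<in> \<Gamma>"
    then show "?f (s, t) = \<Squnion>{v \<in> partial_units Q. qsupp Q v \<sqsubseteq> spt s \<and> qsupp Q (v\<^sup>\<star>) \<sqsubseteq> spt t \<and>
        v \<bullet> t \<sqsubseteq>\<^bsub>X\<^esub> s}"
      by (simp add: ip_def ip_units_sections)
  qed (use sp in auto)
  then have "inner_product Q X act = ?f"
    unfolding inner_product_def using is_inner_product_unique by (intro the_equality) blast+
  then show ?thesis using assms by simp
qed

lemma spt_le_ip: "s \<in> \<Gamma> \<Longrightarrow> spt s \<sqsubseteq> ip s s"
  by (intro le_ip ip_unitsI[of _ s]) auto

lemma principal_section_ip_le: "s \<in> principal_sections Q X act \<Longrightarrow> ip s s \<sqsubseteq> \<e>"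
  using inner_product_eq[of s s] by (auto simp: principal_sections_def)

end

section \<open>Commuting sheaf structures\<close>

text \<open>
  A bisheaf, with the right action of \<open>R\<close> replaced by the left action \<open>r \<unrhd> x = x r\<^sup>\<star>\<close>.  In this
  form \<open>Q\<close> and \<open>R\<close> play symmetric roles, and passing to the dual exchanges them.
\<close>

locale commuting_sheaves = A: quantal_sheaf Q X actQ + B: quantal_sheaf R X actR
  for Q :: "('q, 'm) iquantale_scheme" and R :: "('r, 'k) iquantale_scheme"
    and X :: "('x, 'n) gorder_scheme"
    and actQ :: "'q \<Rightarrow> 'x \<Rightarrow> 'x" (infixr \<open>\<rhd>\<close> 78)
    and actR :: "'r \<Rightarrow> 'x \<Rightarrow> 'x" (infixr \<open>\<unrhd>\<close> 78) +
  assumes act_commute: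
    "\<lbrakk>a \<in> carrier Q; r \<in> carrier R; x \<in> carrier X\<rbrakk> \<Longrightarrow> a \<rhd> r \<unrhd> x = r \<unrhd> a \<rhd> x"
begin

lemma commuting_sheaves_sym: "commuting_sheaves R Q X actR actQ"
  by unfold_locales (simp add: act_commute)

lemma spt_act_other_le:
  assumes r: "r \<in> carrier R" and x: "x \<in> carrier X"
  shows "A.spt (r \<unrhd> x) \<sqsubseteq>\<^bsub>Q\<^esub> A.spt x"
proof -
  have b: "A.spt x \<in> base Q" using x by simp
  have "r \<unrhd> x = A.spt x \<rhd> r \<unrhd> x"
    using act_commute[of "A.spt x" r x] r x b by simp
  also have "\<dots> \<sqsubseteq>\<^bsub>X\<^esub> A.spt x \<rhd> \<top>\<^bsub>X\<^esub>" using r x b by (intro A.act_mono) auto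
  finally show ?thesis using r x b by (simp add: A.spt_le_iff)
qed

lemma section_act_other:
  assumes r: "r \<in> partial_units R" and t: "t \<in> A.sections"
  shows "r \<unrhd> t \<in> A.sections"
proof (rule A.sectionI)
  let ?r = "r\<^sup>\<star>\<^bsub>R\<^esub>"
  fix z assume z: "z \<in> carrier X" "z \<sqsubseteq>\<^bsub>X\<^esub> r \<unrhd> t"
  have rz: "r \<unrhd> ?r \<unrhd> z = z" using B.partial_unit_act_restrict[of r t z] r t z by simp
  have "?r \<unrhd> z \<sqsubseteq>\<^bsub>X\<^esub> ?r \<unrhd> r \<unrhd> t" using r t z by (intro B.act_mono) auto
  also have "\<dots> \<sqsubseteq>\<^bsub>X\<^esub> t" using r t by (simp add: B.partial_unit_act_le)
  finally have zt: "A.spt (?r \<unrhd> z) \<rhd> t = ?r \<unrhd> z" using r t z by (intro A.section_restrict) auto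
  have "A.spt (?r \<unrhd> z) = A.spt z"
    using spt_act_other_le[of ?r z] spt_act_other_le[of r "?r \<unrhd> z"] r z rz
    by (intro A.le_antisym) auto
  then have "A.spt z \<rhd> r \<unrhd> t = r \<unrhd> A.spt (?r \<unrhd> z) \<rhd> t"
    using r t z by (simp add: act_commute)
  then show "A.spt z \<rhd> r \<unrhd> t = z" using zt rz by simp
qed (use r t in simp)

text \<open>For the inner product over \<open>Q\<close>, the action of a partial unit of \<open>R\<close> is adjoint to the action
  of its involute.\<close>

lemma ip_partial_unit_other_le:
  assumes r: "r \<in> partial_units R" and x: "x \<in> carrier X" and y: "y \<in> carrier X"
  shows "A.ip (r \<unrhd> x) y \<sqsubseteq>\<^bsub>Q\<^esub> A.ip x (r\<^sup>\<star>\<^bsub>R\<^esub> \<unrhd> y)"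
proof (rule A.ip_le[OF A.ip_closed A.le_ip])
  let ?r = "r\<^sup>\<star>\<^bsub>R\<^esub>"
  fix v assume "v \<in> A.ip_units (r \<unrhd> x) y"
  then obtain t where t: "v \<in> partial_units Q" "t \<in> A.sections" "t \<sqsubseteq>\<^bsub>X\<^esub> y"
    "v\<^sup>\<star>\<^bsub>Q\<^esub> \<cdot>\<^bsub>Q\<^esub> v \<sqsubseteq>\<^bsub>Q\<^esub> A.spt t" "v \<rhd> t \<sqsubseteq>\<^bsub>X\<^esub> r \<unrhd> x" by (rule A.ip_unitsE)
  let ?d = "v\<^sup>\<star>\<^bsub>Q\<^esub> \<cdot>\<^bsub>Q\<^esub> v"
  have d: "?d \<in> base Q" using t by simp
  show "v \<in> A.ip_units x (?r \<unrhd> y)"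
  proof (rule A.ip_unitsI[OF t(1) section_act_other[OF B.partial_unit_star[OF r] t(2)]])
    show "?r \<unrhd> t \<sqsubseteq>\<^bsub>X\<^esub> ?r \<unrhd> y" using r t y by (intro B.act_mono) auto
    have "v \<rhd> ?r \<unrhd> t = ?r \<unrhd> v \<rhd> t" using r t by (simp add: act_commute)
    also have "\<dots> \<sqsubseteq>\<^bsub>X\<^esub> ?r \<unrhd> r \<unrhd> x" using r t x by (intro B.act_mono) auto
    also have "\<dots> \<sqsubseteq>\<^bsub>X\<^esub> x" using r x by (simp add: B.partial_unit_act_le)
    finally show "v \<rhd> ?r \<unrhd> t \<sqsubseteq>\<^bsub>X\<^esub> x" using r t x by simp
    have vt: "r \<unrhd> ?r \<unrhd> v \<rhd> t = v \<rhd> t"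
      using B.partial_unit_act_restrict[of r x "v \<rhd> t"] r t x by simp
    have "?d = A.spt (?d \<rhd> t)"
      using t d A.base_le_mult[of ?d "A.spt t"] by (simp add: A.spt_act_base)
    also have "?d \<rhd> t = v\<^sup>\<star>\<^bsub>Q\<^esub> \<rhd> r \<unrhd> ?r \<unrhd> v \<rhd> t" using t vt by (simp add: A.act_mult)
    also have "\<dots> = r \<unrhd> ?d \<rhd> ?r \<unrhd> t"
      using r t act_commute[of v ?r t] act_commute[of "v\<^sup>\<star>\<^bsub>Q\<^esub>" r "v \<rhd> ?r \<unrhd> t"]
      by (simp add: A.act_mult)
    also have "A.spt \<dots> \<sqsubseteq>\<^bsub>Q\<^esub> A.spt (?d \<rhd> ?r \<unrhd> t)" using r t by (intro spt_act_other_le) auto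
    also have "\<dots> \<sqsubseteq>\<^bsub>Q\<^esub> A.spt (?r \<unrhd> t)"
      using r t d by (intro A.spt_mono A.base_act_le) auto
    finally show "?d \<sqsubseteq>\<^bsub>Q\<^esub> A.spt (?r \<unrhd> t)" using r t d by simp
  qed
qed

lemma ip_partial_unit_other:
  assumes r: "r \<in> partial_units R" and x: "x \<in> carrier X" and y: "y \<in> carrier X"
  shows "A.ip (r \<unrhd> x) y = A.ip x (r\<^sup>\<star>\<^bsub>R\<^esub> \<unrhd> y)"
proof (rule A.le_antisym)
  have "(A.ip (r\<^sup>\<star>\<^bsub>R\<^esub> \<unrhd> y) x)\<^sup>\<star>\<^bsub>Q\<^esub> \<sqsubseteq>\<^bsub>Q\<^esub> (A.ip y (r \<unrhd> x))\<^sup>\<star>\<^bsub>Q\<^esub>"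
    using ip_partial_unit_other_le[of "r\<^sup>\<star>\<^bsub>R\<^esub>" y x] assms by (intro A.star_mono) auto
  then show "A.ip x (r\<^sup>\<star>\<^bsub>R\<^esub> \<unrhd> y) \<sqsubseteq>\<^bsub>Q\<^esub> A.ip (r \<unrhd> x) y"
    using assms by (simp add: A.ip_star)
qed (use assms in \<open>simp_all add: ip_partial_unit_other_le\<close>)

lemma ip_act_other:
  assumes r: "r \<in> carrier R" and x: "x \<in> carrier X" and y: "y \<in> carrier X"
  shows "A.ip (r \<unrhd> x) y = A.ip x (r\<^sup>\<star>\<^bsub>R\<^esub> \<unrhd> y)"
proof -
  let ?S = "{s \<in> partial_units R. s \<sqsubseteq>\<^bsub>R\<^esub> r}"
  have S: "?S \<subseteq> carrier R" "(\<lambda>s. s\<^sup>\<star>\<^bsub>R\<^esub>) ` ?S \<subseteq> carrier R" by auto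
  have "A.ip (r \<unrhd> x) y = A.ip (\<Squnion>\<^bsub>X\<^esub>((\<lambda>s. s \<unrhd> x) ` ?S)) y"
    using sup_presD[OF B.act_Sup_left[OF x] S(1)] r by (simp add: B.Sup_partial_units_below)
  also have "\<dots> = \<Squnion>\<^bsub>Q\<^esub>((\<lambda>x. A.ip x y) ` (\<lambda>s. s \<unrhd> x) ` ?S)"
    using x y by (intro A.ip_Sup_left) auto
  also have "(\<lambda>x. A.ip x y) ` (\<lambda>s. s \<unrhd> x) ` ?S
      = (\<lambda>y. A.ip x y) ` (\<lambda>s. s \<unrhd> y) ` (\<lambda>s. s\<^sup>\<star>\<^bsub>R\<^esub>) ` ?S"
    unfolding image_image using x y by (intro image_cong) (auto simp: ip_partial_unit_other)
  also have "\<Squnion>\<^bsub>Q\<^esub>\<dots> = A.ip x (\<Squnion>\<^bsub>X\<^esub>((\<lambda>s. s \<unrhd> y) ` (\<lambda>s. s\<^sup>\<star>\<^bsub>R\<^esub>) ` ?S))"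
    using x y by (intro A.ip_Sup_right[symmetric]) auto
  also have "\<Squnion>\<^bsub>X\<^esub>((\<lambda>s. s \<unrhd> y) ` (\<lambda>s. s\<^sup>\<star>\<^bsub>R\<^esub>) ` ?S) = r\<^sup>\<star>\<^bsub>R\<^esub> \<unrhd> y"
    using sup_presD[OF B.act_Sup_left[OF y] S(2)] sup_presD[OF B.star_Sup S(1)] r
    by (simp add: B.Sup_partial_units_below)
  finally show ?thesis .
qed

end

text \<open>
  Every element invariant under one of the quantales is \<open>c \<cdot> \<top>\<close> for some \<open>c\<close> in the base of the other.
  In groupoid terms, each groupoid acts transitively on the fibres of the anchor map of the other.
\<close>

locale transitive_sheaves = commuting_sheaves +
  assumes actR_invariant:
    "\<lbrakk>x \<in> carrier X; \<top>\<^bsub>R\<^esub> \<unrhd> x = x\<rbrakk> \<Longrightarrow> \<exists>c\<in>base Q. c \<rhd> \<top>\<^bsub>X\<^esub> = x"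
  and actQ_invariant:
    "\<lbrakk>x \<in> carrier X; \<top>\<^bsub>Q\<^esub> \<rhd> x = x\<rbrakk> \<Longrightarrow> \<exists>c\<in>base R. c \<unrhd> \<top>\<^bsub>X\<^esub> = x"
begin

lemma transitive_sheaves_sym: "transitive_sheaves R Q X actR actQ"
  using commuting_sheaves_sym
  by (simp add: transitive_sheaves_def transitive_sheaves_axioms_def actR_invariant actQ_invariant)

lemma spt_act_top_le:
  assumes t: "t \<in> carrier X"
  shows "A.spt t \<rhd> \<top>\<^bsub>X\<^esub> \<sqsubseteq>\<^bsub>X\<^esub> \<top>\<^bsub>R\<^esub> \<unrhd> t"
proof -
  have "\<top>\<^bsub>R\<^esub> \<cdot>\<^bsub>R\<^esub> \<top>\<^bsub>R\<^esub> = \<top>\<^bsub>R\<^esub>"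
    using B.mult_mono[of "\<top>\<^bsub>R\<^esub>" "\<top>\<^bsub>R\<^esub>" "\<e>\<^bsub>R\<^esub>" "\<top>\<^bsub>R\<^esub>"] by (intro B.le_antisym) auto
  then have "\<top>\<^bsub>R\<^esub> \<unrhd> \<top>\<^bsub>R\<^esub> \<unrhd> t = \<top>\<^bsub>R\<^esub> \<unrhd> t" using t by (simp flip: B.act_mult)
  then obtain c where c: "c \<in> base Q" "c \<rhd> \<top>\<^bsub>X\<^esub> = \<top>\<^bsub>R\<^esub> \<unrhd> t"
    using actR_invariant[of "\<top>\<^bsub>R\<^esub> \<unrhd> t"] t by auto
  have "t \<sqsubseteq>\<^bsub>X\<^esub> \<top>\<^bsub>R\<^esub> \<unrhd> t" using B.act_mono[of "\<e>\<^bsub>R\<^esub>" "\<top>\<^bsub>R\<^esub>" t t] t by simp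
  then have "A.spt t \<sqsubseteq>\<^bsub>Q\<^esub> c" using t c by (simp add: A.spt_le_iff)
  then show ?thesis using t c(1) unfolding c(2)[symmetric] by (intro A.act_mono) auto
qed

text \<open>
  The heart of the imprimitivity identity.  In groupoid terms, points of \<open>t\<close> and \<open>z\<close> in the same
  fibre of the anchor map of \<open>Q\<close> differ by an element of the groupoid of \<open>R\<close>, and the inner product
  over \<open>R\<close> collects all these elements.
\<close>

lemma spt_act_le_ip_act:
  assumes t: "t \<in> carrier X" and z: "z \<in> carrier X"
  shows "A.spt t \<rhd> z \<sqsubseteq>\<^bsub>X\<^esub> B.ip z t \<unrhd> t"
proof -
  let ?S = "{s \<in> B.sections. s \<sqsubseteq>\<^bsub>X\<^esub> z}"
  have S: "?S \<subseteq> carrier X" by auto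
  have piece: "m \<sqsubseteq>\<^bsub>X\<^esub> B.ip z t \<unrhd> t"
    if w: "w \<in> partial_units R" and z': "z' \<in> ?S"
      and m: "m \<in> carrier X" "m \<sqsubseteq>\<^bsub>X\<^esub> z'" "m \<sqsubseteq>\<^bsub>X\<^esub> w \<unrhd> t" for w z' m
  proof -
    \<comment> \<open>\<open>w\<close> carries the part \<open>w\<^sup>\<star> \<unrhd> m\<close> of \<open>t\<close> onto \<open>m\<close>, hence contributes to the inner product.\<close>
    let ?w = "w\<^sup>\<star>\<^bsub>R\<^esub>" and ?u = "B.spt m \<cdot>\<^bsub>R\<^esub> w"
    have mS: "m \<in> B.sections" using B.section_down z' m by blast
    have b: "B.spt m \<in> base R" using m by simp
    have wm: "w \<unrhd> ?w \<unrhd> m = m" using B.partial_unit_act_restrict[of w t m] w t m by simp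
    have "?u \<in> B.ip_units z t"
    proof (rule B.ip_unitsI[of _ "?w \<unrhd> m"])
      show "?w \<unrhd> m \<in> B.sections" using w mS by (simp add: B.partial_unit_act_section)
      have "?w \<unrhd> m \<sqsubseteq>\<^bsub>X\<^esub> ?w \<unrhd> w \<unrhd> t" using w t m by (intro B.act_mono) auto
      also have "\<dots> \<sqsubseteq>\<^bsub>X\<^esub> t" using w t by (simp add: B.partial_unit_act_le)
      finally show "?w \<unrhd> m \<sqsubseteq>\<^bsub>X\<^esub> t" using w t m by simp
      have "?u\<^sup>\<star>\<^bsub>R\<^esub> \<cdot>\<^bsub>R\<^esub> ?u = ?w \<cdot>\<^bsub>R\<^esub> ((B.spt m \<cdot>\<^bsub>R\<^esub> B.spt m) \<cdot>\<^bsub>R\<^esub> w)"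
        using w b by (simp only: B.star_mult B.base_star B.mult_assoc B.mult_closed
            B.base_closed B.partial_unit_closed B.star_closed)
      also have "\<dots> = B.spt (?w \<unrhd> m)" using w m by (simp add: B.spt_partial_unit_act)
      finally show "?u\<^sup>\<star>\<^bsub>R\<^esub> \<cdot>\<^bsub>R\<^esub> ?u \<sqsubseteq>\<^bsub>R\<^esub> B.spt (?w \<unrhd> m)" using w m by simp
      have "?u \<unrhd> ?w \<unrhd> m = m" using wm w m by (simp add: B.act_mult)
      then show "?u \<unrhd> ?w \<unrhd> m \<sqsubseteq>\<^bsub>X\<^esub> z" using z' m z A.X.le_trans[of m z' z] by simp
    qed (use w b in simp)
    then have u: "?u \<sqsubseteq>\<^bsub>R\<^esub> B.ip z t" by (rule B.le_ip)
    have "m = B.spt m \<unrhd> m" using m by simp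
    also have "\<dots> \<sqsubseteq>\<^bsub>X\<^esub> B.spt m \<unrhd> w \<unrhd> t" using w t m by (intro B.act_mono) auto
    also have "\<dots> = ?u \<unrhd> t" using w t m by (simp add: B.act_mult)
    also have "\<dots> \<sqsubseteq>\<^bsub>X\<^esub> B.ip z t \<unrhd> t" using u w t m by (intro B.act_mono) auto
    finally show ?thesis using w t m by simp
  qed
  have "A.spt t \<rhd> z' \<sqsubseteq>\<^bsub>X\<^esub> B.ip z t \<unrhd> t" if z': "z' \<in> ?S" for z'
  proof -
    let ?n = "A.spt t \<rhd> z'" and ?W = "(\<lambda>w. w \<unrhd> t) ` partial_units R"
    have zc: "z' \<in> carrier X" using z' by auto
    have W: "?W \<subseteq> carrier X" using t by auto
    have n: "?n \<in> carrier X" "?n \<sqsubseteq>\<^bsub>X\<^esub> z'" using zc t by (auto intro: A.base_act_le)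
    have "?n \<sqsubseteq>\<^bsub>X\<^esub> A.spt t \<rhd> \<top>\<^bsub>X\<^esub>" using zc t by (intro A.act_mono) auto
    also have "\<dots> \<sqsubseteq>\<^bsub>X\<^esub> \<top>\<^bsub>R\<^esub> \<unrhd> t" by (rule spt_act_top_le[OF t])
    also have "\<dots> = \<Squnion>\<^bsub>X\<^esub>?W"
      using sup_presD[OF B.act_Sup_left[OF t], of "partial_units R"]
      by (simp add: B.Sup_partial_units subset_iff)
    finally have "?n \<sqsubseteq>\<^bsub>X\<^esub> \<Squnion>\<^bsub>X\<^esub>?W" using zc t W by simp
    then have "?n = \<Squnion>\<^bsub>X\<^esub>((\<lambda>a. ?n \<sqinter>\<^bsub>X\<^esub> a) ` ?W)"
      using A.X.meet_Sup[of ?n ?W] n W by (simp add: A.X.meet_eq_left)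
    also have "\<dots> \<sqsubseteq>\<^bsub>X\<^esub> B.ip z t \<unrhd> t"
    proof (rule A.X.sup_least)
      fix m assume "m \<in> (\<lambda>a. ?n \<sqinter>\<^bsub>X\<^esub> a) ` ?W"
      then obtain w where w: "w \<in> partial_units R" "m = ?n \<sqinter>\<^bsub>X\<^esub> w \<unrhd> t" by auto
      then have "m \<in> carrier X" "m \<sqsubseteq>\<^bsub>X\<^esub> ?n" "m \<sqsubseteq>\<^bsub>X\<^esub> w \<unrhd> t"
        using n t by (auto intro: A.X.meet_left A.X.meet_right)
      then show "m \<sqsubseteq>\<^bsub>X\<^esub> B.ip z t \<unrhd> t"
        using piece[OF w(1) z'] n zc A.X.le_trans[of m ?n z'] by simp
    qed (use n W t in auto)
    finally show ?thesis .
  qed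
  moreover have "A.spt t \<rhd> z = \<Squnion>\<^bsub>X\<^esub>((\<lambda>z'. A.spt t \<rhd> z') ` ?S)"
    using sup_presD[OF A.act_Sup_right[of "A.spt t"] S] t z by (simp add: B.section_Sup)
  ultimately show ?thesis
    using t by (simp only:) (rule A.X.sup_least, auto)
qed

lemma imprimitivity_le:
  assumes x: "x \<in> carrier X" and y: "y \<in> carrier X" and z: "z \<in> carrier X"
  shows "A.ip x y \<rhd> z \<sqsubseteq>\<^bsub>X\<^esub> B.ip z y \<unrhd> x"
proof -
  have "A.ip x y \<rhd> z = \<Squnion>\<^bsub>X\<^esub>((\<lambda>v. v \<rhd> z) ` A.ip_units x y)"
    unfolding A.ip_def by (rule sup_presD[OF A.act_Sup_left[OF z] A.ip_units_closed])
  also have "\<dots> \<sqsubseteq>\<^bsub>X\<^esub> B.ip z y \<unrhd> x"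
  proof (rule A.X.sup_least)
    fix p assume "p \<in> (\<lambda>v. v \<rhd> z) ` A.ip_units x y"
    then obtain v where v: "p = v \<rhd> z" "v \<in> A.ip_units x y" by blast
    from v(2) obtain t where t: "v \<in> partial_units Q" "t \<in> A.sections" "t \<sqsubseteq>\<^bsub>X\<^esub> y"
      "v\<^sup>\<star>\<^bsub>Q\<^esub> \<cdot>\<^bsub>Q\<^esub> v \<sqsubseteq>\<^bsub>Q\<^esub> A.spt t" "v \<rhd> t \<sqsubseteq>\<^bsub>X\<^esub> x" by (rule A.ip_unitsE)
    have "v \<rhd> z = (v \<cdot>\<^bsub>Q\<^esub> A.spt t) \<rhd> z" using t by (simp add: A.partial_unit_spt(2))
    also have "\<dots> = v \<rhd> A.spt t \<rhd> z" using t z by (simp add: A.act_mult)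
    also have "\<dots> \<sqsubseteq>\<^bsub>X\<^esub> v \<rhd> B.ip z t \<unrhd> t"
      using t z by (intro A.act_mono spt_act_le_ip_act) auto
    also have "\<dots> = B.ip z t \<unrhd> v \<rhd> t" using t by (simp add: act_commute)
    also have "\<dots> \<sqsubseteq>\<^bsub>X\<^esub> B.ip z y \<unrhd> x"
      using t x y z by (intro B.act_mono B.ip_mono) auto
    finally show "p \<sqsubseteq>\<^bsub>X\<^esub> B.ip z y \<unrhd> x" using t x z v by simp
  qed (use x z in \<open>auto elim: A.ip_unitsE\<close>)
  finally show ?thesis .
qed

text \<open>In terms of the right action this is \<open>\<langle>x, y\<rangle> z = x [y, z]\<close>, for the inner products \<open>\<langle>-, -\<rangle>\<close>
  over \<open>Q\<close> and \<open>[-, -]\<close> over \<open>R\<close>.  The two inequalities are mirror images of each other.\<close>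

lemma imprimitivity:
  assumes x: "x \<in> carrier X" and y: "y \<in> carrier X" and z: "z \<in> carrier X"
  shows "A.ip x y \<rhd> z = B.ip z y \<unrhd> x"
proof -
  interpret S: transitive_sheaves R Q X actR actQ by (rule transitive_sheaves_sym)
  show ?thesis
    using imprimitivity_le[OF x y z] S.imprimitivity_le[OF z y x] x z by (intro A.X.le_antisym) auto
qed

end

section \<open>The tensor product as a lattice of closed relations\<close>

text \<open>
  The principal sections over \<open>Q\<close> are now required to cover, and the base of \<open>Q\<close> to act faithfully
  enough that only the unit fixes \<open>\<top>\<close>.  This makes the inner product over \<open>Q\<close> an isomorphism from
  the tensor product over \<open>R\<close> onto \<open>Q\<close>.
\<close>

locale principal_transitive_sheaves = transitive_sheaves Q R X actQ actR
  for Q :: "('q, 'm) iquantale_scheme" and R :: "('r, 'k) iquantale_scheme"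
    and X :: "('x, 'n) gorder_scheme"
    and actQ :: "'q \<Rightarrow> 'x \<Rightarrow> 'x" (infixr \<open>\<rhd>\<close> 78)
    and actR :: "'r \<Rightarrow> 'x \<Rightarrow> 'x" (infixr \<open>\<unrhd>\<close> 78) +
  assumes principal_cover: "\<Squnion>\<^bsub>X\<^esub>(principal_sections Q X actQ) = \<top>\<^bsub>X\<^esub>"
    and faithful: "\<lbrakk>b \<in> base Q; b \<rhd> \<top>\<^bsub>X\<^esub> = \<top>\<^bsub>X\<^esub>\<rbrakk> \<Longrightarrow> b = \<e>\<^bsub>Q\<^esub>"
begin

abbreviation psections :: "'x set" where "psections \<equiv> principal_sections Q X actQ"

lemma psection_section [simp]: "s \<in> psections \<Longrightarrow> s \<in> A.sections"
  unfolding principal_sections_def by blast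

text \<open>The principal sections resolve the unit, since \<open>\<langle>s, s\<rangle>\<close> lies between the support of \<open>s\<close> and
  the unit.\<close>

lemma Sup_ip_psections: "\<Squnion>\<^bsub>Q\<^esub>((\<lambda>s. A.ip s s) ` psections) = \<e>\<^bsub>Q\<^esub>"
proof (rule A.le_antisym)
  have P: "psections \<subseteq> carrier X" by auto
  show "\<Squnion>\<^bsub>Q\<^esub>((\<lambda>s. A.ip s s) ` psections) \<sqsubseteq>\<^bsub>Q\<^esub> \<e>\<^bsub>Q\<^esub>"
    by (intro A.sup_least) (auto intro: A.principal_section_ip_le)
  have "A.spt \<top>\<^bsub>X\<^esub> = \<e>\<^bsub>Q\<^esub>" using A.X.top_closed by (intro faithful) simp_all
  then have "\<e>\<^bsub>Q\<^esub> = \<Squnion>\<^bsub>Q\<^esub>(A.spt ` psections)" using A.spt_Sup[OF P] principal_cover by simp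
  also have "\<dots> \<sqsubseteq>\<^bsub>Q\<^esub> \<Squnion>\<^bsub>Q\<^esub>((\<lambda>s. A.ip s s) ` psections)"
  proof (rule A.sup_least)
    fix b assume "b \<in> A.spt ` psections"
    then obtain s where "s \<in> psections" "b = A.spt s" by blast
    then show "b \<sqsubseteq>\<^bsub>Q\<^esub> \<Squnion>\<^bsub>Q\<^esub>((\<lambda>s. A.ip s s) ` psections)"
      by (intro A.le_sup_I[of _ "A.ip s s"]) (auto intro: A.spt_le_ip)
  qed (auto intro!: A.sup_closed)
  finally show "\<e>\<^bsub>Q\<^esub> \<sqsubseteq>\<^bsub>Q\<^esub> \<Squnion>\<^bsub>Q\<^esub>((\<lambda>s. A.ip s s) ` psections)" .
qed (auto intro!: A.sup_closed)

text \<open>The relations that are closed for the tensor product over \<open>R\<close>, whose right action on the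
  first factor is \<open>x \<cdot> r = r\<^sup>\<star> \<unrhd> x\<close>.\<close>

definition closed_relations :: "('x \<times> 'x) set set" where
  "closed_relations =
     {D. D \<subseteq> carrier X \<times> carrier X \<and>
         (\<forall>A y. A \<subseteq> carrier X \<longrightarrow> y \<in> carrier X \<longrightarrow>
            ((\<Squnion>\<^bsub>X\<^esub>A, y) \<in> D \<longleftrightarrow> A \<times> {y} \<subseteq> D)) \<and>
         (\<forall>x B. x \<in> carrier X \<longrightarrow> B \<subseteq> carrier X \<longrightarrow>
            ((x, \<Squnion>\<^bsub>X\<^esub>B) \<in> D \<longleftrightarrow> {x} \<times> B \<subseteq> D)) \<and>
         (\<forall>x r y. x \<in> carrier X \<longrightarrow> r \<in> carrier R \<longrightarrow> y \<in> carrier X \<longrightarrow>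
            ((r\<^sup>\<star>\<^bsub>R\<^esub> \<unrhd> x, y) \<in> D \<longleftrightarrow> (x, r \<unrhd> y) \<in> D))}"

text \<open>The closed relation that corresponds to an element of \<open>Q\<close>, and the value in \<open>Q\<close> of the tensor
  that corresponds to a relation, i.e. of the join of its pairs \<open>x \<otimes> y\<close> under \<open>x \<otimes> y \<mapsto> \<langle>x, y\<rangle>\<close>.\<close>

definition ip_relation :: "'q \<Rightarrow> ('x \<times> 'x) set" where
  "ip_relation a = {(x, y). x \<in> carrier X \<and> y \<in> carrier X \<and> A.ip x y \<sqsubseteq>\<^bsub>Q\<^esub> a}"

definition ip_value :: "('x \<times> 'x) set \<Rightarrow> 'q" where
  "ip_value D = \<Squnion>\<^bsub>Q\<^esub>((\<lambda>(x, y). A.ip x y) ` D)"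

lemma ip_value_closed [simp]: "ip_value D \<in> carrier Q"
  unfolding ip_value_def by (rule A.sup_closed) auto

lemma ip_value_le_iff:
  "\<lbrakk>D \<subseteq> carrier X \<times> carrier X; a \<in> carrier Q\<rbrakk> \<Longrightarrow> ip_value D \<sqsubseteq>\<^bsub>Q\<^esub> a \<longleftrightarrow> D \<subseteq> ip_relation a"
  unfolding ip_value_def ip_relation_def by (subst A.sup_le_iff) auto

lemma ip_relation_closed:
  assumes a: "a \<in> carrier Q"
  shows "ip_relation a \<in> closed_relations"
proof -
  have "A.ip (r\<^sup>\<star>\<^bsub>R\<^esub> \<unrhd> x) y = A.ip x (r \<unrhd> y)"
    if "r \<in> carrier R" "x \<in> carrier X" "y \<in> carrier X" for r x y
    using ip_act_other[of "r\<^sup>\<star>\<^bsub>R\<^esub>" x y] that by simp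
  then show ?thesis
    using a unfolding closed_relations_def ip_relation_def
    by (auto simp: A.ip_Sup_left A.ip_Sup_right A.sup_le_iff image_subset_iff)
qed

text \<open>This is the surjectivity of \<open>x \<otimes> y \<mapsto> \<langle>x, y\<rangle>\<close>: the element \<open>a\<close> is the join of the
  \<open>\<langle>a s, s\<rangle> = a \<langle>s, s\<rangle>\<close> over the principal sections \<open>s\<close>.\<close>

lemma ip_value_of_relation:
  assumes a: "a \<in> carrier Q"
  shows "ip_value (ip_relation a) = a"
proof (rule A.le_antisym)
  have sub: "ip_relation a \<subseteq> carrier X \<times> carrier X" by (auto simp: ip_relation_def)
  show "ip_value (ip_relation a) \<sqsubseteq>\<^bsub>Q\<^esub> a" using a sub by (simp add: ip_value_le_iff)
  have "a = a \<cdot>\<^bsub>Q\<^esub> \<Squnion>\<^bsub>Q\<^esub>((\<lambda>s. A.ip s s) ` psections)" using a by (simp add: Sup_ip_psections)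
  also have "\<dots> = \<Squnion>\<^bsub>Q\<^esub>((\<lambda>b. a \<cdot>\<^bsub>Q\<^esub> b) ` (\<lambda>s. A.ip s s) ` psections)"
    using a by (intro sup_presD[OF A.mult_Sup_right]) auto
  also have "\<dots> \<sqsubseteq>\<^bsub>Q\<^esub> ip_value (ip_relation a)"
  proof (rule A.sup_least)
    fix b assume "b \<in> (\<lambda>b. a \<cdot>\<^bsub>Q\<^esub> b) ` (\<lambda>s. A.ip s s) ` psections"
    then obtain s where s: "s \<in> psections" "b = a \<cdot>\<^bsub>Q\<^esub> A.ip s s" by blast
    then have sX: "s \<in> carrier X" by simp
    have b: "b = A.ip (a \<rhd> s) s" using s sX a by (simp add: A.ip_act_left)
    have "b \<sqsubseteq>\<^bsub>Q\<^esub> a \<cdot>\<^bsub>Q\<^esub> \<e>\<^bsub>Q\<^esub>"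
      unfolding s(2) using s a by (intro A.mult_mono A.principal_section_ip_le) auto
    then have "(a \<rhd> s, s) \<in> ip_relation a" using a sX b by (simp add: ip_relation_def)
    then show "b \<sqsubseteq>\<^bsub>Q\<^esub> ip_value (ip_relation a)"
      unfolding b ip_value_def by (intro A.sup_upper) auto
  qed (use a in auto)
  finally show "a \<sqsubseteq>\<^bsub>Q\<^esub> ip_value (ip_relation a)" .
qed (use a in auto)

lemma
  assumes D: "D \<in> closed_relations"
  shows closed_relation_carrier: "D \<subseteq> carrier X \<times> carrier X"
    and closed_relation_Sup_left:
      "\<lbrakk>A \<subseteq> carrier X; y \<in> carrier X\<rbrakk> \<Longrightarrow> (\<Squnion>\<^bsub>X\<^esub>A, y) \<in> D \<longleftrightarrow> A \<times> {y} \<subseteq> D"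
    and closed_relation_Sup_right:
      "\<lbrakk>x \<in> carrier X; B \<subseteq> carrier X\<rbrakk> \<Longrightarrow> (x, \<Squnion>\<^bsub>X\<^esub>B) \<in> D \<longleftrightarrow> {x} \<times> B \<subseteq> D"
    and closed_relation_balanced:
      "\<lbrakk>x \<in> carrier X; r \<in> carrier R; y \<in> carrier X\<rbrakk> \<Longrightarrow> (r\<^sup>\<star>\<^bsub>R\<^esub> \<unrhd> x, y) \<in> D \<longleftrightarrow> (x, r \<unrhd> y) \<in> D"
  using D by (simp_all add: closed_relations_def)

lemma closed_relation_down:
  assumes D: "D \<in> closed_relations" and xy: "(x', y') \<in> D"
    and le: "x \<in> carrier X" "y \<in> carrier X" "x \<sqsubseteq>\<^bsub>X\<^esub> x'" "y \<sqsubseteq>\<^bsub>X\<^esub> y'"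
  shows "(x, y) \<in> D"
proof -
  have c: "x' \<in> carrier X" "y' \<in> carrier X" using closed_relation_carrier[OF D] xy by auto
  have "(x, y') \<in> D"
    using closed_relation_Sup_left[OF D, of "{x, x'}" y'] A.X.sup_pair[of x x'] xy c le by simp
  then show ?thesis
    using closed_relation_Sup_right[OF D, of x "{y, y'}"] A.X.sup_pair[of y y'] c le by simp
qed

text \<open>Imprimitivity moves the inner product across the tensor sign.\<close>

lemma closed_relation_transfer:
  assumes D: "D \<in> closed_relations" and x: "x \<in> carrier X" and y: "y \<in> carrier X" and s: "s \<in> carrier X"
  shows "(x, A.ip s s \<rhd> y) \<in> D \<longleftrightarrow> (A.ip x y \<rhd> s, s) \<in> D"
  using closed_relation_balanced[OF D x, of "B.ip y s" s] imprimitivity[of s s y] imprimitivity[of x y s]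
    x y s by (simp add: B.ip_star)

text \<open>
  This is the injectivity of \<open>x \<otimes> y \<mapsto> \<langle>x, y\<rangle>\<close>.  In the tensor product, \<open>x \<otimes> y\<close> is the join over the
  principal sections \<open>s\<close> of \<open>x \<otimes> \<langle>s, s\<rangle> y = \<langle>x, y\<rangle> s \<otimes> s\<close>, which depends on \<open>\<langle>x, y\<rangle>\<close> only.
\<close>

lemma ip_relation_of_value:
  assumes D: "D \<in> closed_relations"
  shows "ip_relation (ip_value D) = D"
proof
  have DX: "D \<subseteq> carrier X \<times> carrier X" using closed_relation_carrier[OF D] .
  then show "D \<subseteq> ip_relation (ip_value D)" by (simp flip: ip_value_le_iff)
  show "ip_relation (ip_value D) \<subseteq> D"
  proof
    fix p assume "p \<in> ip_relation (ip_value D)"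
    then obtain x y where p: "p = (x, y)" and x: "x \<in> carrier X" and y: "y \<in> carrier X"
      and le: "A.ip x y \<sqsubseteq>\<^bsub>Q\<^esub> ip_value D" by (auto simp: ip_relation_def)
    have piece: "(x, A.ip s s \<rhd> y) \<in> D" if "s \<in> psections" for s
    proof -
      have s: "s \<in> carrier X" using that by simp
      have small: "(A.ip x' y' \<rhd> s, s) \<in> D" if d: "(x', y') \<in> D" for x' y'
      proof -
        have c: "x' \<in> carrier X" "y' \<in> carrier X" using DX d by auto
        have "A.ip s s \<rhd> y' \<sqsubseteq>\<^bsub>X\<^esub> \<e>\<^bsub>Q\<^esub> \<rhd> y'"
          using \<open>s \<in> psections\<close> c by (intro A.act_mono A.principal_section_ip_le) auto
        then have "(x', A.ip s s \<rhd> y') \<in> D"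
          using closed_relation_down[OF D d, of x' "A.ip s s \<rhd> y'"] c s by simp
        then show ?thesis using closed_relation_transfer[OF D] c s by simp
      qed
      let ?V = "(\<lambda>(x, y). A.ip x y) ` D"
      have V: "?V \<subseteq> carrier Q" by auto
      have W: "(\<lambda>a. a \<rhd> s) ` ?V \<subseteq> carrier X" using V s by auto
      have "(\<lambda>a. a \<rhd> s) ` ?V \<times> {s} \<subseteq> D" using small by auto
      then have "(\<Squnion>\<^bsub>X\<^esub>((\<lambda>a. a \<rhd> s) ` ?V), s) \<in> D"
        using closed_relation_Sup_left[OF D W s] by blast
      moreover have "ip_value D \<rhd> s = \<Squnion>\<^bsub>X\<^esub>((\<lambda>a. a \<rhd> s) ` ?V)"
        unfolding ip_value_def by (rule sup_presD[OF A.act_Sup_left[OF s] V])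
      ultimately have "(ip_value D \<rhd> s, s) \<in> D" by simp
      then have "(A.ip x y \<rhd> s, s) \<in> D"
        by (rule closed_relation_down[OF D]) (use le s in \<open>auto intro: A.act_mono\<close>)
      then show ?thesis using closed_relation_transfer[OF D x y s] by simp
    qed
    let ?E = "(\<lambda>s. A.ip s s) ` psections"
    have "y = \<Squnion>\<^bsub>Q\<^esub>?E \<rhd> y" using y by (simp add: Sup_ip_psections)
    also have "\<dots> = \<Squnion>\<^bsub>X\<^esub>((\<lambda>a. a \<rhd> y) ` ?E)"
      by (rule sup_presD[OF A.act_Sup_left[OF y]]) auto
    finally have "y = \<Squnion>\<^bsub>X\<^esub>((\<lambda>a. a \<rhd> y) ` ?E)" .
    moreover have "(x, \<Squnion>\<^bsub>X\<^esub>((\<lambda>a. a \<rhd> y) ` ?E)) \<in> D"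
    proof -
      have E: "(\<lambda>a. a \<rhd> y) ` ?E \<subseteq> carrier X" using y by auto
      have "{x} \<times> (\<lambda>a. a \<rhd> y) ` ?E \<subseteq> D" using piece by auto
      then show ?thesis using closed_relation_Sup_right[OF D x E] by blast
    qed
    ultimately show "p \<in> D" unfolding p by (simp only:)
  qed
qed

lemma closure_eq_ip_relation:
  assumes U: "U \<subseteq> carrier X \<times> carrier X"
  shows "\<Inter>{D \<in> closed_relations. U \<subseteq> D} = ip_relation (ip_value U)"
proof
  show "\<Inter>{D \<in> closed_relations. U \<subseteq> D} \<subseteq> ip_relation (ip_value U)"
    using U by (intro Inter_lower) (simp add: ip_relation_closed flip: ip_value_le_iff)
  have "ip_relation (ip_value U) \<subseteq> D" if D: "D \<in> closed_relations" "U \<subseteq> D" for D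
  proof -
    have "ip_value U \<sqsubseteq>\<^bsub>Q\<^esub> ip_value D"
      using U D ip_relation_of_value[OF D(1)] by (simp add: ip_value_le_iff)
    then have "ip_value (ip_relation (ip_value U)) \<sqsubseteq>\<^bsub>Q\<^esub> ip_value D"
      by (simp add: ip_value_of_relation)
    then show ?thesis
      using ip_relation_of_value[OF D(1)] ip_value_le_iff[of "ip_relation (ip_value U)" "ip_value D"]
      by (auto simp: ip_relation_def)
  qed
  then show "ip_relation (ip_value U) \<subseteq> \<Inter>{D \<in> closed_relations. U \<subseteq> D}" by blast
qed

lemma ip_value_act_left:
  assumes a: "a \<in> carrier Q" and D: "D \<subseteq> carrier X \<times> carrier X"
  shows "ip_value ((\<lambda>(x, y). (a \<rhd> x, y)) ` D) = a \<cdot>\<^bsub>Q\<^esub> ip_value D"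
proof -
  have "a \<cdot>\<^bsub>Q\<^esub> ip_value D = \<Squnion>\<^bsub>Q\<^esub>((\<lambda>b. a \<cdot>\<^bsub>Q\<^esub> b) ` (\<lambda>(x, y). A.ip x y) ` D)"
    unfolding ip_value_def by (rule sup_presD[OF A.mult_Sup_right[OF a]]) auto
  also have "(\<lambda>b. a \<cdot>\<^bsub>Q\<^esub> b) ` (\<lambda>(x, y). A.ip x y) ` D = (\<lambda>(x, y). A.ip x y) ` (\<lambda>(x, y). (a \<rhd> x, y)) ` D"
    unfolding image_image using a D by (intro image_cong) (auto simp: A.ip_act_left)
  finally show ?thesis by (simp add: ip_value_def)
qed

lemma ip_value_act_right:
  assumes a: "a \<in> carrier Q" and D: "D \<subseteq> carrier X \<times> carrier X"
  shows "ip_value ((\<lambda>(x, y). (x, a\<^sup>\<star>\<^bsub>Q\<^esub> \<rhd> y)) ` D) = ip_value D \<cdot>\<^bsub>Q\<^esub> a"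
proof -
  have "ip_value D \<cdot>\<^bsub>Q\<^esub> a = \<Squnion>\<^bsub>Q\<^esub>((\<lambda>b. b \<cdot>\<^bsub>Q\<^esub> a) ` (\<lambda>(x, y). A.ip x y) ` D)"
    unfolding ip_value_def by (rule sup_presD[OF A.mult_Sup_left[OF a]]) auto
  also have "(\<lambda>b. b \<cdot>\<^bsub>Q\<^esub> a) ` (\<lambda>(x, y). A.ip x y) ` D
      = (\<lambda>(x, y). A.ip x y) ` (\<lambda>(x, y). (x, a\<^sup>\<star>\<^bsub>Q\<^esub> \<rhd> y)) ` D"
    unfolding image_image using a D by (intro image_cong) (auto simp: A.ip_act_right)
  finally show ?thesis by (simp add: ip_value_def)
qed

end

section \<open>Mutually dual principal bisheaves\<close>

text \<open>The notions of sheaf theory depend on the underlying order only.\<close>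

context
  fixes X :: "('x, 'm) gorder_scheme" and Y :: "('x, 'n) gorder_scheme"
  assumes carrier_eq: "carrier Y = carrier X" and le_eq: "le Y = le X"
begin

lemma Sup_cong_order: "\<Squnion>\<^bsub>Y\<^esub>A = \<Squnion>\<^bsub>X\<^esub>A"
  by (simp add: sup_def least_def Upper_def carrier_eq le_eq)

lemma meet_cong_order: "x \<sqinter>\<^bsub>Y\<^esub> y = x \<sqinter>\<^bsub>X\<^esub> y"
  by (simp add: meet_def inf_def greatest_def Lower_def carrier_eq le_eq)

lemma top_cong_order: "\<top>\<^bsub>Y\<^esub> = \<top>\<^bsub>X\<^esub>"
  by (simp add: top_def greatest_def carrier_eq le_eq)

lemma sup_pres_cong_order:
  assumes "complete_lattice X" "complete_lattice Y"
  shows "sup_pres Y L f \<longleftrightarrow> sup_pres X L f" "sup_pres L Y g \<longleftrightarrow> sup_pres L X g"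
    "sup_pres Y Y h \<longleftrightarrow> sup_pres X X h"
  using assms by (simp_all add: sup_pres_def Sup_cong_order carrier_eq)

lemma left_sheaf_cong_order:
  assumes X: "frame X" and Y: "left_sheaf Q Y act"
  shows "left_sheaf Q X act"
proof -
  have c: "complete_lattice X" "complete_lattice Y"
    using X Y by (auto simp: frame_def left_sheaf_def left_locale_def)
  note eqs = c carrier_eq le_eq Sup_cong_order meet_cong_order top_cong_order sup_pres_cong_order[OF c]
  have "sheaf_support Q Y act = sheaf_support Q X act"
    by (simp add: sheaf_support_def eqs fun_eq_iff)
  moreover from this have "local_sections Q Y act = local_sections Q X act"
    by (simp add: local_sections_def supp_def eqs)
  moreover have "left_locale Q X act"
    using X Y by (simp add: left_sheaf_def left_locale_def left_module_def eqs)
  ultimately show ?thesis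
    using Y by (simp add: left_sheaf_def eqs)
qed

end

lemma left_sheaf_frame: "left_sheaf Q X act \<Longrightarrow> frame X"
  by (simp add: left_sheaf_def left_locale_def)

lemma order_iso_on_surj:
  assumes "order_iso_on L B M C f" "x \<in> C"
  shows "\<exists>c\<in>B. f c = x"
  using assms by (auto simp: order_iso_on_def bij_betw_def)

text \<open>
  The pair \<open>X\<close>, \<open>Y\<close> of mutually dual bisheaves is treated symmetrically: the bidual of a bisheaf
  agrees with it on the carriers, but need not be the same record.
\<close>

definition dual_bisheaves ::
    "'q iquantale \<Rightarrow> 'r iquantale \<Rightarrow> ('q, 'r, 'x) bimod \<Rightarrow> ('r, 'q, 'x) bimod \<Rightarrow> bool" where
  "dual_bisheaves Q R X Y \<longleftrightarrow>
     carrier Y = carrier X \<and> le Y = le X \<and>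
     (\<forall>r\<in>carrier R. \<forall>x\<in>carrier X. lact Y r x = ract X x (r\<^sup>\<star>\<^bsub>R\<^esub>)) \<and>
     (\<forall>a\<in>carrier Q. \<forall>x\<in>carrier X. ract Y x a = lact X (a\<^sup>\<star>\<^bsub>Q\<^esub>) x)"

lemma dual_bisheaves_dual_bimod: "dual_bisheaves Q R X (dual_bimod Q R X)"
  by (simp add: dual_bisheaves_def dual_bimod_def)

lemma dual_bisheaves_sym:
  assumes "inverse_quantal_frame Q" "inverse_quantal_frame R" "dual_bisheaves Q R X Y"
  shows "dual_bisheaves R Q Y X"
proof -
  interpret Q: inverse_quantal_frame Q by fact
  interpret R: inverse_quantal_frame R by fact
  show ?thesis using assms(3) by (simp add: dual_bisheaves_def)
qed

lemma bisheaf_map_order_iso: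
  assumes Y: "frame Y" and eqX: "eq X = (=)"
    and f: "\<And>y. y \<in> carrier Y \<Longrightarrow> f y \<in> carrier X"
    and g: "\<And>x. x \<in> carrier X \<Longrightarrow> g x \<in> carrier Y"
    and gf: "\<And>y. y \<in> carrier Y \<Longrightarrow> g (f y) = y"
    and fg: "\<And>x. x \<in> carrier X \<Longrightarrow> f (g x) = x"
    and le: "\<And>y z. \<lbrakk>y \<in> carrier Y; z \<in> carrier Y\<rbrakk> \<Longrightarrow> f y \<sqsubseteq>\<^bsub>X\<^esub> f z \<longleftrightarrow> y \<sqsubseteq>\<^bsub>Y\<^esub> z"
    and lact: "\<And>a y. \<lbrakk>a \<in> carrier Q; y \<in> carrier Y\<rbrakk> \<Longrightarrow> f (lact Y a y) = lact X a (f y)"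
    and ract: "\<And>y r. \<lbrakk>y \<in> carrier Y; r \<in> carrier R\<rbrakk> \<Longrightarrow> f (ract Y y r) = ract X (f y) r"
  shows "bisheaf_map Q R X Y f"
proof -
  have "frame X" "sup_pres Y X f" "f \<top>\<^bsub>Y\<^esub> = \<top>\<^bsub>X\<^esub>"
    by (rule frame_order_iso[OF Y eqX, of f g]; simp add: f g gf fg le)+
  moreover have "f (y \<sqinter>\<^bsub>Y\<^esub> z) = f y \<sqinter>\<^bsub>X\<^esub> f z" if "y \<in> carrier Y" "z \<in> carrier Y" for y z
    by (rule frame_order_iso(4)[OF Y eqX, of f g]) (simp_all add: f g gf fg le that)
  ultimately show ?thesis
    using Y by (simp add: bisheaf_map_def Pi_def f lact ract)
qed

lemma principal_transitive_sheaves_bimod: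
  fixes Q :: "'q iquantale" and R :: "'r iquantale"
    and X :: "('q, 'r, 'x) bimod" and Y :: "('r, 'q, 'x) bimod"
  assumes Q: "inverse_quantal_frame Q" and R: "inverse_quantal_frame R"
    and X: "principal_bisheaf Q R X" and Y: "principal_bisheaf R Q Y"
    and dual: "dual_bisheaves Q R X Y"
  shows "principal_transitive_sheaves Q R X (lact X) (lact Y)"
proof -
  interpret Q: inverse_quantal_frame Q by (rule Q)
  interpret R: inverse_quantal_frame R by (rule R)
  have carr: "carrier Y = carrier X" and le: "le Y = le X"
    and lactY: "\<And>r x. r \<in> carrier R \<Longrightarrow> x \<in> carrier X \<Longrightarrow> lact Y r x = ract X x (r\<^sup>\<star>\<^bsub>R\<^esub>)"
    and ractY: "\<And>a x. a \<in> carrier Q \<Longrightarrow> x \<in> carrier X \<Longrightarrow> ract Y x a = lact X (a\<^sup>\<star>\<^bsub>Q\<^esub>) x"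
    using dual by (simp_all add: dual_bisheaves_def)
  have lsX: "left_sheaf Q X (lact X)" and lsY': "left_sheaf R Y (lact Y)"
    and com: "\<And>a x r. a \<in> carrier Q \<Longrightarrow> x \<in> carrier X \<Longrightarrow> r \<in> carrier R \<Longrightarrow>
        ract X (lact X a x) r = lact X a (ract X x r)"
    and isoX: "order_iso_on R (base R) X (invariants Q X) (\<lambda>c. ract X \<top>\<^bsub>X\<^esub> c)"
    and isoY: "order_iso_on Q (base Q) Y (invariants R Y) (\<lambda>c. ract Y \<top>\<^bsub>Y\<^esub> c)"
    and cover: "\<Squnion>\<^bsub>X\<^esub>(principal_sections Q X (lact X)) = \<top>\<^bsub>X\<^esub>"
    using X Y by (simp_all add: principal_bisheaf_def bisheaf_def bimodule_def)
  have lsY: "left_sheaf R X (lact Y)"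
    by (rule left_sheaf_cong_order[OF carr le left_sheaf_frame[OF lsX] lsY'])
  interpret A: quantal_sheaf Q X "lact X"
    using Q lsX left_sheaf_frame[OF lsX] by (simp add: quantal_sheaf_def quantal_sheaf_axioms_def)
  interpret B: quantal_sheaf R X "lact Y"
    using R lsY left_sheaf_frame[OF lsX] by (simp add: quantal_sheaf_def quantal_sheaf_axioms_def)
  have top: "\<top>\<^bsub>Y\<^esub> = \<top>\<^bsub>X\<^esub>" by (rule top_cong_order[OF carr le])
  have cX: "ract X \<top>\<^bsub>X\<^esub> c = lact Y c \<top>\<^bsub>X\<^esub>" if "c \<in> base R" for c
    using that by (simp add: lactY)
  have cY: "ract Y \<top>\<^bsub>Y\<^esub> c = lact X c \<top>\<^bsub>X\<^esub>" if "c \<in> base Q" for c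
    using that by (simp add: ractY top)
  show ?thesis
  proof
    show "lact X a (lact Y r x) = lact Y r (lact X a x)"
      if "a \<in> carrier Q" "r \<in> carrier R" "x \<in> carrier X" for a r x
      using that by (simp add: lactY com)
    show "\<exists>c\<in>base Q. lact X c \<top>\<^bsub>X\<^esub> = x" if "x \<in> carrier X" "lact Y \<top>\<^bsub>R\<^esub> x = x" for x
      using order_iso_on_surj[OF isoY, of x] that cY by (auto simp: invariants_def carr)
    show "\<exists>c\<in>base R. lact Y c \<top>\<^bsub>X\<^esub> = x" if "x \<in> carrier X" "lact X \<top>\<^bsub>Q\<^esub> x = x" for x
      using order_iso_on_surj[OF isoX, of x] that cX by (auto simp: invariants_def)
    show "b = \<e>\<^bsub>Q\<^esub>" if b: "b \<in> base Q" "lact X b \<top>\<^bsub>X\<^esub> = \<top>\<^bsub>X\<^esub>" for b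
    proof -
      have "inj_on (\<lambda>c. ract Y \<top>\<^bsub>Y\<^esub> c) (base Q)"
        using isoY by (simp add: order_iso_on_def bij_betw_def)
      then show ?thesis
        using b by (auto simp: cY dest!: inj_onD[of _ _ b "\<e>\<^bsub>Q\<^esub>"])
    qed
  qed (rule cover)
qed

text \<open>
  The isomorphism takes a closed relation to the join of the inner products of its pairs.  It is an
  order isomorphism, so the frame structure of the tensor product is transported from \<open>Q\<close>.
\<close>

lemma tensor_dual_iso_unit:
  fixes Q :: "'q iquantale" and R :: "'r iquantale"
    and X :: "('q, 'r, 'x) bimod" and Y :: "('r, 'q, 'x) bimod"
  assumes Q: "inverse_quantal_frame Q" and R: "inverse_quantal_frame R"
    and X: "principal_bisheaf Q R X" and Y: "principal_bisheaf R Q Y"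
    and dual: "dual_bisheaves Q R X Y"
  shows "same_HS_morphism Q Q (tensor R X Y) (unit_bimod Q)"
proof -
  interpret principal_transitive_sheaves Q R X "lact X" "lact Y"
    using assms by (rule principal_transitive_sheaves_bimod)
  let ?T = "tensor R X Y" and ?U = "unit_bimod Q"
  let ?f = ip_relation and ?g = ip_value
  have carr: "carrier Y = carrier X" and le: "le Y = le X"
    and lactY: "\<And>r x. r \<in> carrier R \<Longrightarrow> x \<in> carrier X \<Longrightarrow> lact Y r x = ract X x (r\<^sup>\<star>\<^bsub>R\<^esub>)"
    and ractY: "\<And>a x. a \<in> carrier Q \<Longrightarrow> x \<in> carrier X \<Longrightarrow> ract Y x a = lact X (a\<^sup>\<star>\<^bsub>Q\<^esub>) x"
    using dual by (simp_all add: dual_bisheaves_def)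
  have "lact Y (r\<^sup>\<star>\<^bsub>R\<^esub>) x = ract X x r" if "r \<in> carrier R" "x \<in> carrier X" for r x
    using that by (simp add: lactY)
  then have sets: "tensor_sets R X Y = closed_relations"
    unfolding tensor_sets_def closed_relations_def
    by (simp add: carr Sup_cong_order[OF carr le] cong: conj_cong imp_cong)
  have closure: "tensor_closure R X Y U = ?f (?g U)" if "U \<subseteq> carrier X \<times> carrier X" for U
    unfolding tensor_closure_def sets by (rule closure_eq_ip_relation[OF that])
  have rel: "D \<subseteq> carrier X \<times> carrier X" if "D \<in> closed_relations" for D
    using closed_relation_carrier[OF that] .
  have T: "carrier ?T = closed_relations" "eq ?T = (=)" "le ?T = (\<subseteq>)"
    by (simp_all add: tensor_def sets)
  have U: "carrier ?U = carrier Q" "eq ?U = (=)" "le ?U = le Q"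
    by (simp_all add: unit_bimod_def A.eq_is_equal)
  have lactU: "lact ?U a b = a \<cdot>\<^bsub>Q\<^esub> b" "ract ?U a b = a \<cdot>\<^bsub>Q\<^esub> b" for a b
    by (simp_all add: unit_bimod_def)
  have lactT: "lact ?T a D = ?f (a \<cdot>\<^bsub>Q\<^esub> ?g D)" if "a \<in> carrier Q" "D \<in> closed_relations" for a D
  proof -
    have "(\<lambda>(x, y). (lact X a x, y)) ` D \<subseteq> carrier X \<times> carrier X" using rel[OF that(2)] that(1) by auto
    then show ?thesis using closure rel that by (simp add: tensor_def ip_value_act_left)
  qed
  have ractT: "ract ?T D a = ?f (?g D \<cdot>\<^bsub>Q\<^esub> a)" if "a \<in> carrier Q" "D \<in> closed_relations" for a D
  proof -
    have "(\<lambda>(x, y). (x, lact X (a\<^sup>\<star>\<^bsub>Q\<^esub>) y)) ` D \<subseteq> carrier X \<times> carrier X" using rel[OF that(2)] that(1) by auto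
    moreover have "(\<lambda>(x, y). (x, ract Y y a)) ` D = (\<lambda>(x, y). (x, lact X (a\<^sup>\<star>\<^bsub>Q\<^esub>) y)) ` D"
      using rel[OF that(2)] that(1) by (intro image_cong) (auto simp: ractY)
    ultimately show ?thesis using closure rel that by (simp add: tensor_def ip_value_act_right)
  qed
  have frU: "frame ?U"
    by (rule frame_order_iso(1)[OF A.frame_axioms, where f = "\<lambda>x. x" and g = "\<lambda>x. x"]) (simp_all add: U)
  have order: "?f a \<sqsubseteq>\<^bsub>?T\<^esub> ?f b \<longleftrightarrow> a \<sqsubseteq>\<^bsub>?U\<^esub> b" if "a \<in> carrier Q" "b \<in> carrier Q" for a b
    using that rel[OF ip_relation_closed] ip_value_le_iff[of "?f a" b]
    by (simp add: T U ip_value_of_relation)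
  have f: "bisheaf_map Q Q ?T ?U ?f"
    by (rule bisheaf_map_order_iso[OF frU T(2), of _ ?g])
      (simp_all add: T U order[unfolded T U] lactU lactT ractT ip_relation_closed ip_value_of_relation
        ip_relation_of_value)
  then have frT: "frame ?T" by (simp add: bisheaf_map_def)
  have order': "?g D \<sqsubseteq>\<^bsub>?U\<^esub> ?g E \<longleftrightarrow> D \<sqsubseteq>\<^bsub>?T\<^esub> E"
    if "D \<in> closed_relations" "E \<in> closed_relations" for D E
    using order[of "?g D" "?g E"] that by (simp add: ip_relation_of_value)
  have "bisheaf_map Q Q ?U ?T ?g"
    by (rule bisheaf_map_order_iso[OF frT U(2), of _ ?f])
      (simp_all add: T U order'[unfolded T U] lactU lactT ractT ip_relation_closed ip_value_of_relation
        ip_relation_of_value)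
  with f show ?thesis
    unfolding same_HS_morphism_def
    by (intro exI[of _ ?f] exI[of _ ?g]) (simp add: T U ip_value_of_relation ip_relation_of_value)
qed

theorem theorem5p19:
  fixes Q :: "'q iquantale" and R :: "'r iquantale" and X :: "('q, 'r, 'x) bimod"
  assumes "inverse_quantal_frame Q" and "inverse_quantal_frame R" and "bisheaf Q R X"
  shows "biprincipal_bisheaf Q R X \<longleftrightarrow>
    principal_bisheaf Q R X \<and>
    principal_bisheaf R Q (dual_bimod Q R X) \<and>
    same_HS_morphism Q Q (tensor R X (dual_bimod Q R X)) (unit_bimod Q) \<and>
    same_HS_morphism R R (tensor Q (dual_bimod Q R X) X) (unit_bimod R)"
  using tensor_dual_iso_unit[OF assms(1,2) _ _ dual_bisheaves_dual_bimod[of Q R X]]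
    tensor_dual_iso_unit[OF assms(2,1) _ _ dual_bisheaves_sym[OF assms(1,2) dual_bisheaves_dual_bimod[of Q R X]]]
  unfolding biprincipal_bisheaf_def by blast

end
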